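(* Fix an integer $r\ge 2$ and a constant $M>0$. Suppose $H_n\sim \mathsf{H}_{[r]}(n,\boldsymbol B)$ is a sample from the $r$-layered hypergraph $\boldsymbol\beta$-model with parameters $\boldsymbol B=(\boldsymbol\beta_2,\ldots,\boldsymbol\beta_r)$, where $\boldsymbol\beta_s\in\mathbb R^n$ and $\|\boldsymbol\beta_s\|_\infty\le M$ for all $2\le s\le r$. Then with probability $1-o(1)$ as $n\to\infty$ the likelihood equations $$d_s(v)=\sum_{\{v_2,\ldots,v_s\}\in\binom{[n]\setminus\{v\}}{s-1}}\frac{e^{\hat\beta_{s,v}+\hat\beta_{s,v_2}+\cdots+\hat\beta_{s,v_s}}}{1+e^{\hat\beta_{s,v}+\hat\beta_{s,v_2}+\cdots+\hat\beta_{s,v_s}}},\qquad v\in[n],\ 2\le s\le r,$$ have a unique solution $\hat{\boldsymbol B}=(\hat{\boldsymbol\beta}_2,\ldots,\hat{\boldsymbol\beta}_r)$, and it satisfies $$\|\hat{\boldsymbol\beta}_s-\boldsymbol\beta_s\|_2\lesssim_{s,M}\sqrt{\frac{1}{n^{s-2}}}\quad\text{and}\quad \|\hat{\boldsymbol\beta}_s-\boldsymbol\beta_s\|_\infty\lesssim_{s,M}\sqrt{\frac{\log n}{n^{s-1}}},\qquad 2\le s\le r.$$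
   Context: $[n]=\{1,\ldots,n\}$ and $\binom{A}{k}$ is the collection of $k$-element subsets of a set $A$. The $r$-layered hypergraph $\boldsymbol\beta$-model $\mathsf{H}_{[r]}(n,\boldsymbol B)$, with $\boldsymbol\beta_s=(\beta_{s,v})_{v\in[n]}\in\mathbb R^n$, is the random hypergraph on vertex set $[n]$ in which, for every $2\le s\le r$, each hyperedge $\{v_1,\ldots,v_s\}\in\binom{[n]}{s}$ is present independently with probability $\frac{e^{\beta_{s,v_1}+\cdots+\beta_{s,v_s}}}{1+e^{\beta_{s,v_1}+\cdots+\beta_{s,v_s}}}$ (no other hyperedges). The $s$-degree $d_s(v)$ is the number of hyperedges of size $s$ in $H_n$ containing $v$. $\|\cdot\|_2,\|\cdot\|_\infty$ are the usual norms on $\mathbb R^n$. $a_n\lesssim_{s,M} b_n$ means $a_n\le C b_n$ for all large $n$, with a constant $C>0$ depending only on $s$ and $M$. The parameters may depend on $n$; $r$ and $M$ are fixed. *)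

theory Defs
  imports "HOL-Probability.Probability" "HOL-Library.Ramsey"
begin

text \<open>
  A vector in real \<open>n\<close>-space is a function \<open>nat \<Rightarrow> real\<close>, of which only the values on
  \<open>{1..n}\<close> matter; a parameter family \<open>B\<close> has \<open>B s v\<close> for the coordinate \<open>v\<close> of the
  layer-\<open>s\<close> vector. The \<open>k\<close>-element subsets of a finite set \<open>A\<close> are \<open>nsets A k\<close>, the
  Euclidean norm is \<open>L2_set\<close>. A hypergraph is identified with its set of hyperedges.
\<close>

text \<open>For \<open>n = 0\<close> the value is unspecified, which is irrelevant for asymptotic statements in \<open>n\<close>.\<close>
definition linf_norm :: "nat \<Rightarrow> (nat \<Rightarrow> real) \<Rightarrow> real" where
  "linf_norm n x = Max ((\<lambda>v. \<bar>x v\<bar>) ` {1..n})"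

definition edge_prob :: "(nat \<Rightarrow> real) \<Rightarrow> nat set \<Rightarrow> real" where
  "edge_prob b e = exp (\<Sum>v\<in>e. b v) / (1 + exp (\<Sum>v\<in>e. b v))"

definition potential_edges :: "nat \<Rightarrow> nat \<Rightarrow> nat set set" where
  "potential_edges r n = (\<Union>s\<in>{2..r}. nsets {1..n} s)"

definition layered_beta_model :: "nat \<Rightarrow> nat \<Rightarrow> (nat \<Rightarrow> nat \<Rightarrow> real) \<Rightarrow> nat set set pmf" where
  "layered_beta_model r n B =
     map_pmf (\<lambda>X. {e \<in> potential_edges r n. X e})
       (Pi_pmf (potential_edges r n) False (\<lambda>e. bernoulli_pmf (edge_prob (B (card e)) e)))"

definition sdegree :: "nat set set \<Rightarrow> nat \<Rightarrow> nat \<Rightarrow> nat" where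
  "sdegree H s v = card {e \<in> H. card e = s \<and> v \<in> e}"

text \<open>
  Extensional families (value \<open>undefined\<close> outside the index sets) represent the elements of
  the product of \<open>r - 1\<close> copies of real \<open>n\<close>-space uniquely, so that uniqueness of a
  solution can be expressed by equality of functions.
\<close>
definition param_space :: "nat \<Rightarrow> nat \<Rightarrow> (nat \<Rightarrow> nat \<Rightarrow> real) set" where
  "param_space r n = {2..r} \<rightarrow>\<^sub>E ({1..n} \<rightarrow>\<^sub>E UNIV)"

definition likelihood_eqs ::
    "nat \<Rightarrow> nat \<Rightarrow> nat set set \<Rightarrow> (nat \<Rightarrow> nat \<Rightarrow> real) \<Rightarrow> bool" where
  "likelihood_eqs r n H Bh \<longleftrightarrow>
     (\<forall>s\<in>{2..r}. \<forall>v\<in>{1..n}.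
        real (sdegree H s v) =
          (\<Sum>T\<in>nsets ({1..n} - {v}) (s - 1).
             exp (Bh s v + (\<Sum>u\<in>T. Bh s u)) / (1 + exp (Bh s v + (\<Sum>u\<in>T. Bh s u)))))"

end

theory Submission
  imports Defs
begin

text \<open>
  The layers decouple, so fix \<open>s\<close>, put \<open>\<Delta> = \<beta>\<^sub>h - \<beta>\<close> for a candidate \<open>\<beta>\<^sub>h\<close>, and let \<open>D\<close> be the vector of
  centred degrees. By the mean value theorem the likelihood equations become a linear system
  \<open>L \<Delta> = D\<close>, where the quadratic form of \<open>L\<close> is \<open>\<Sum>e. w e * (\<Sum>v\<in>e. \<Delta> v)\<^sup>2\<close>, with weights bounded
  away from 0 as long as \<open>\<Delta>\<close> stays bounded. The form is bounded below by a multiple of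
  \<open>n ^ (s - 1)\<close>, which gives the Euclidean bound; inserting this bound into a single row of the
  system gives the bound for the maximum norm.

  To make \<open>\<Delta>\<close> bounded in the first place, minimise the negative log-likelihood over the box
  \<open>\<bar>\<Delta> v\<bar> \<le> 1\<close>. The minimiser satisfies \<open>L \<Delta> = D + r\<close> with \<open>r v * \<Delta> v \<le> 0\<close>, and both bounds survive
  this perturbation. Hence the minimiser is interior for large \<open>n\<close>, so \<open>r = 0\<close>. Uniqueness is strict
  monotonicity of the logistic function.

  The Euclidean norm of \<open>D\<close> is controlled by Chebyshev's inequality for the off-diagonal part of
  the quadratic form \<open>\<Sum>v. (D v)\<^sup>2\<close> in the centred edge indicators (Markov's inequality would not
  give a bounded constant with probability tending to 1), and its maximum norm by Hoeffding's
  inequality.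
\<close>

section \<open>Uniform hypergraph counts and quadratic forms\<close>

definition nsets_at :: "'a set \<Rightarrow> nat \<Rightarrow> 'a \<Rightarrow> 'a set set" where
  "nsets_at V s v = {e \<in> nsets V s. v \<in> e}"

lemma finite_nsets_at [simp]: "finite V \<Longrightarrow> finite (nsets_at V s v)"
  by (simp add: nsets_at_def finite_imp_finite_nsets)

lemma card_nsets: "finite V \<Longrightarrow> card (nsets V k) = card V choose k"
proof -
  assume V: "finite V"
  have "nsets V k = {B. B \<subseteq> V \<and> card B = k}"
    using V by (auto simp: nsets_def dest: finite_subset)
  with V show ?thesis by (simp add: n_subsets)
qed

text \<open>The likelihood equations are indexed by the \<open>(s - 1)\<close>-sets avoiding
  \<open>v\<close>, the quadratic forms by the edges through \<open>v\<close>; this translates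
  between the two.\<close>

lemma bij_betw_insert_nsets:
  assumes "finite V" "v \<in> V" "s \<ge> 1"
  shows "bij_betw (insert v) (nsets (V - {v}) (s - 1)) (nsets_at V s v)"
proof (rule bij_betwI[where g = "\<lambda>e. e - {v}"])
  show "insert v \<in> nsets (V - {v}) (s - 1) \<rightarrow> nsets_at V s v"
    using assms by (auto simp: nsets_def nsets_at_def card_insert_if)
  show "(\<lambda>e. e - {v}) \<in> nsets_at V s v \<rightarrow> nsets (V - {v}) (s - 1)"
    using assms by (auto simp: nsets_def nsets_at_def)
qed (auto simp: nsets_def nsets_at_def)

lemma sum_nsets_at:
  assumes "finite V" "v \<in> V" "s \<ge> 1"
  shows "(\<Sum>T\<in>nsets (V - {v}) (s - 1). g (insert v T)) = (\<Sum>e\<in>nsets_at V s v. g e)"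
  using sum.reindex_bij_betw[OF bij_betw_insert_nsets[OF assms], of g] by simp

lemma card_nsets_at:
  assumes "finite V" "v \<in> V" "s \<ge> 1"
  shows "card (nsets_at V s v) = (card V - 1) choose (s - 1)"
  using bij_betw_same_card[OF bij_betw_insert_nsets[OF assms]] assms
  by (simp add: card_nsets)

lemma card_nsets_at_at:
  assumes "finite V" "v \<in> V" "u \<in> V" "u \<noteq> v" "s \<ge> 2"
  shows "card {e \<in> nsets_at V s v. u \<in> e} = (card V - 2) choose (s - 2)"
proof -
  have "card {e \<in> nsets_at V s v. u \<in> e} = (\<Sum>e\<in>nsets_at V s v. if u \<in> e then 1 else 0)"
    using assms by (simp add: sum.inter_filter[symmetric])
  also have "\<dots> = (\<Sum>T\<in>nsets (V - {v}) (s - 1). if u \<in> insert v T then 1 else 0)"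
    using assms by (intro sum_nsets_at[symmetric]) auto
  also have "\<dots> = (\<Sum>T\<in>nsets (V - {v}) (s - 1). if u \<in> T then 1 else 0)"
    using assms by (intro sum.cong) auto
  also have "\<dots> = card (nsets_at (V - {v}) (s - 1) u)"
    using assms
    by (simp add: sum.inter_filter[symmetric] nsets_at_def finite_imp_finite_nsets)
  also have "\<dots> = (card V - 2) choose (s - 2)"
    using assms by (subst card_nsets_at) (auto simp: numeral_2_eq_2)
  finally show ?thesis .
qed

text \<open>Double counting of incidences: summing over the edges at a vertex is adjoint to summing
  a vertex function over an edge. It turns the pairing of a system of rows with a vector into a form
  over edges.\<close>

lemma sum_nsets_at_swap:
  fixes x :: "'a \<Rightarrow> real"
  assumes "finite V"
  shows "(\<Sum>v\<in>V. x v * (\<Sum>e\<in>nsets_at V s v. g e)) = (\<Sum>e\<in>nsets V s. g e * (\<Sum>v\<in>e. x v))"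
proof -
  have *: "finite (nsets V s)" using assms by (simp add: finite_imp_finite_nsets)
  have "(\<Sum>v\<in>V. x v * (\<Sum>e\<in>nsets_at V s v. g e))
          = (\<Sum>v\<in>V. \<Sum>e\<in>nsets V s. if v \<in> e then x v * g e else 0)"
    unfolding nsets_at_def sum.inter_filter[OF *] sum_distrib_left
    by (intro sum.cong refl) auto
  also have "\<dots> = (\<Sum>e\<in>nsets V s. \<Sum>v\<in>V. if v \<in> e then x v * g e else 0)"
    by (rule sum.swap)
  also have "\<dots> = (\<Sum>e\<in>nsets V s. g e * (\<Sum>v\<in>e. x v))"
  proof (rule sum.cong[OF refl])
    fix e assume "e \<in> nsets V s"
    hence "{v \<in> V. v \<in> e} = e" by (auto simp: nsets_def)
    thus "(\<Sum>v\<in>V. if v \<in> e then x v * g e else 0) = g e * (\<Sum>v\<in>e. x v)"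
      using assms by (simp add: sum.inter_filter[symmetric] sum_distrib_left mult.commute)
  qed
  finally show ?thesis .
qed

lemma sum_nsets_at_others:
  fixes x :: "'a \<Rightarrow> real"
  assumes "finite V" "v \<in> V" "s \<ge> 2"
  shows "(\<Sum>e\<in>nsets_at V s v. \<Sum>u\<in>e - {v}. x u)
           = real ((card V - 2) choose (s - 2)) * (\<Sum>u\<in>V - {v}. x u)"
proof -
  have "(\<Sum>e\<in>nsets_at V s v. \<Sum>u\<in>e - {v}. x u)
          = (\<Sum>e\<in>nsets_at V s v. \<Sum>u\<in>V - {v}. if u \<in> e then x u else 0)"
  proof (rule sum.cong[OF refl])
    fix e assume "e \<in> nsets_at V s v"
    hence "{u \<in> V - {v}. u \<in> e} = e - {v}" by (auto simp: nsets_at_def nsets_def)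
    thus "(\<Sum>u\<in>e - {v}. x u) = (\<Sum>u\<in>V - {v}. if u \<in> e then x u else 0)"
      using assms by (simp add: sum.inter_filter[symmetric])
  qed
  also have "\<dots> = (\<Sum>u\<in>V - {v}. \<Sum>e\<in>nsets_at V s v. if u \<in> e then x u else 0)"
    by (rule sum.swap)
  also have "\<dots> = (\<Sum>u\<in>V - {v}. real ((card V - 2) choose (s - 2)) * x u)"
    using assms by (intro sum.cong[OF refl])
      (simp add: sum.inter_filter[symmetric] card_nsets_at_at)
  finally show ?thesis by (simp add: sum_distrib_left)
qed

text \<open>The matrix of the form has \<open>(card V - 1) choose (s - 1)\<close> on the diagonal
  and \<open>b = (card V - 2) choose (s - 2)\<close> elsewhere, so it is \<open>a I + b J\<close>
  with \<open>J\<close> all ones. The form is exactly \<open>a\<close> times the sum of squares plus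
  \<open>b\<close> times the square of the sum, and the latter is dropped.\<close>

lemma sum_nsets_square_ge:
  fixes x :: "'a \<Rightarrow> real"
  assumes "finite V" "s \<ge> 2" "card V \<ge> 2"
  shows "real ((card V - 2) choose (s - 1)) * (\<Sum>v\<in>V. (x v)\<^sup>2)
           \<le> (\<Sum>e\<in>nsets V s. (\<Sum>v\<in>e. x v)\<^sup>2)"
proof -
  let ?a = "real ((card V - 2) choose (s - 1))" and ?b = "real ((card V - 2) choose (s - 2))"
  \<comment> \<open>Pascal's rule splits the diagonal entry into \<open>?a\<close> and the common
    off-diagonal entry \<open>?b\<close>.\<close>
  have pascal: "real ((card V - 1) choose (s - 1)) = ?a + ?b"
  proof -
    obtain k m where "s = Suc (Suc k)" "card V = Suc (Suc m)"
      using assms by (metis Suc_le_D numeral_2_eq_2 Suc_le_mono)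
    thus ?thesis by simp
  qed
  have row: "(\<Sum>e\<in>nsets_at V s v. \<Sum>u\<in>e. x u) = ?a * x v + ?b * (\<Sum>u\<in>V. x u)"
    if v: "v \<in> V" for v
  proof -
    have "(\<Sum>e\<in>nsets_at V s v. \<Sum>u\<in>e. x u)
            = (\<Sum>e\<in>nsets_at V s v. x v + (\<Sum>u\<in>e - {v}. x u))"
      by (intro sum.cong[OF refl]) (auto simp: nsets_at_def nsets_def sum.remove)
    also have "\<dots> = (?a + ?b) * x v + ?b * (\<Sum>u\<in>V - {v}. x u)"
      using assms v by (simp add: sum.distrib sum_nsets_at_others card_nsets_at pascal del: One_nat_def)
    also have "\<dots> = ?a * x v + ?b * (\<Sum>u\<in>V. x u)"
      using assms v by (simp add: sum.remove[of V v] algebra_simps)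
    finally show ?thesis .
  qed
  have "(\<Sum>e\<in>nsets V s. (\<Sum>v\<in>e. x v)\<^sup>2)
          = (\<Sum>v\<in>V. x v * (\<Sum>e\<in>nsets_at V s v. \<Sum>u\<in>e. x u))"
    using assms by (simp add: sum_nsets_at_swap power2_eq_square)
  also have "\<dots> = (\<Sum>v\<in>V. ?a * (x v)\<^sup>2 + (?b * (\<Sum>u\<in>V. x u)) * x v)"
    by (intro sum.cong[OF refl]) (simp add: row power2_eq_square algebra_simps)
  also have "\<dots> = ?a * (\<Sum>v\<in>V. (x v)\<^sup>2) + ?b * (\<Sum>u\<in>V. x u)\<^sup>2"
    by (simp add: sum.distrib sum_distrib_left[symmetric] power2_eq_square)
  finally show ?thesis by simp
qed

section \<open>Stability of linear systems weighted by edges\<close>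

lemma sum_abs_le_L2_set:
  fixes x :: "'a \<Rightarrow> real"
  shows "(\<Sum>v\<in>V. \<bar>x v\<bar>) \<le> sqrt (real (card V)) * L2_set x V"
proof -
  have "(\<Sum>v\<in>V. \<bar>1\<bar> * \<bar>x v\<bar>) \<le> L2_set (\<lambda>_. 1) V * L2_set x V"
    by (rule L2_set_mult_ineq)
  thus ?thesis by (simp add: L2_set_def)
qed

text \<open>Pairing the system with \<Delta> gives a coercive form on the left. On the right
  \<open>r\<close> contributes a nonpositive amount and Cauchy-Schwarz bounds the rest; one factor
  \<open>L2_set \<Delta> V\<close> then cancels.\<close>

lemma weighted_system_L2_bound:
  fixes \<Delta> D r :: "'a \<Rightarrow> real" and w :: "'a set \<Rightarrow> real"
  assumes V: "finite V" "card V \<ge> 2" and s: "s \<ge> 2" and c: "c \<ge> 0"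
    and w: "\<And>e. e \<in> nsets V s \<Longrightarrow> c \<le> w e"
    and eq: "\<And>v. v \<in> V \<Longrightarrow> (\<Sum>e\<in>nsets_at V s v. w e * (\<Sum>u\<in>e. \<Delta> u)) = D v + r v"
    and r: "\<And>v. v \<in> V \<Longrightarrow> r v * \<Delta> v \<le> 0"
  shows "c * real ((card V - 2) choose (s - 1)) * L2_set \<Delta> V \<le> L2_set D V"
proof -
  let ?a = "real ((card V - 2) choose (s - 1))" and ?S = "\<Sum>v\<in>V. (\<Delta> v)\<^sup>2"
  have "c * ?a * ?S \<le> c * (\<Sum>e\<in>nsets V s. (\<Sum>v\<in>e. \<Delta> v)\<^sup>2)"
    using sum_nsets_square_ge[OF V(1) s V(2), of \<Delta>] c by (simp add: mult_left_mono mult.assoc)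
  also have "\<dots> \<le> (\<Sum>e\<in>nsets V s. w e * (\<Sum>u\<in>e. \<Delta> u) * (\<Sum>v\<in>e. \<Delta> v))"
  proof (unfold sum_distrib_left[of c], rule sum_mono)
    fix e assume "e \<in> nsets V s"
    from mult_right_mono[OF w[OF this], of "(\<Sum>v\<in>e. \<Delta> v)\<^sup>2"]
    show "c * (\<Sum>v\<in>e. \<Delta> v)\<^sup>2 \<le> w e * (\<Sum>u\<in>e. \<Delta> u) * (\<Sum>v\<in>e. \<Delta> v)"
      by (simp add: power2_eq_square mult.assoc)
  qed
  also have "\<dots> = (\<Sum>v\<in>V. \<Delta> v * (D v + r v))"
    unfolding sum_nsets_at_swap[OF V(1), symmetric]
    by (intro sum.cong[OF refl]) (simp add: eq)
  also have "\<dots> \<le> (\<Sum>v\<in>V. \<bar>\<Delta> v\<bar> * \<bar>D v\<bar>)"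
  proof (rule sum_mono)
    fix v assume "v \<in> V"
    have "\<Delta> v * D v \<le> \<bar>\<Delta> v\<bar> * \<bar>D v\<bar>" by (metis abs_ge_self abs_mult)
    thus "\<Delta> v * (D v + r v) \<le> \<bar>\<Delta> v\<bar> * \<bar>D v\<bar>" using r[OF \<open>v \<in> V\<close>] by (simp add: algebra_simps)
  qed
  also have "\<dots> \<le> L2_set \<Delta> V * L2_set D V" by (rule L2_set_mult_ineq)
  also have "?S = (L2_set \<Delta> V)\<^sup>2" by (simp add: L2_set_def sum_nonneg)
  finally have "L2_set \<Delta> V * (c * ?a * L2_set \<Delta> V) \<le> L2_set \<Delta> V * L2_set D V"
    by (simp add: power2_eq_square algebra_simps)
  thus ?thesis
    using L2_set_nonneg[of \<Delta> V] by (cases "L2_set \<Delta> V = 0") (auto simp: L2_set_nonneg)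
qed

text \<open>The coefficient of \<open>\<Delta> v\<close> in its own row is a sum of edge weights,
  each at least \<open>c\<close>. The other terms are treated as an error, bounded by the codegree
  times the sum of all \<open>\<bar>\<Delta> u\<bar>\<close> and hence by the Euclidean
  norm.\<close>

lemma weighted_system_row_bound:
  fixes \<Delta> D r :: "'a \<Rightarrow> real" and w :: "'a set \<Rightarrow> real"
  assumes V: "finite V" and s: "s \<ge> 2" and c: "c \<ge> 0"
    and w: "\<And>e. e \<in> nsets V s \<Longrightarrow> c \<le> w e \<and> w e \<le> 1"
    and v: "v \<in> V"
    and eq: "(\<Sum>e\<in>nsets_at V s v. w e * (\<Sum>u\<in>e. \<Delta> u)) = D v + r v"
    and r: "r v * \<Delta> v \<le> 0"
  shows "c * real ((card V - 1) choose (s - 1)) * \<bar>\<Delta> v\<bar>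
           \<le> \<bar>D v\<bar> + real ((card V - 2) choose (s - 2)) * (sqrt (real (card V)) * L2_set \<Delta> V)"
proof -
  define W where "W = (\<Sum>e\<in>nsets_at V s v. w e)"
  define R where "R = (\<Sum>e\<in>nsets_at V s v. w e * (\<Sum>u\<in>e - {v}. \<Delta> u))"
  have w': "c \<le> w e" "w e \<le> 1" "0 \<le> w e" if "e \<in> nsets_at V s v" for e
    using w[of e] c that by (auto simp: nsets_at_def)
  have split: "W * \<Delta> v + R = D v + r v"
  proof -
    have "(\<Sum>e\<in>nsets_at V s v. w e * (\<Sum>u\<in>e. \<Delta> u))
            = (\<Sum>e\<in>nsets_at V s v. w e * \<Delta> v + w e * (\<Sum>u\<in>e - {v}. \<Delta> u))"
      by (intro sum.cong[OF refl])
         (auto simp: nsets_at_def nsets_def sum.remove algebra_simps)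
    thus ?thesis unfolding eq W_def R_def by (simp add: sum.distrib sum_distrib_right)
  qed
  have W: "c * real ((card V - 1) choose (s - 1)) \<le> W"
    using sum_bounded_below[of "nsets_at V s v" c w] w' V v s
    by (simp add: W_def card_nsets_at mult.commute)
  have "\<bar>R\<bar> \<le> (\<Sum>e\<in>nsets_at V s v. \<Sum>u\<in>e - {v}. \<bar>\<Delta> u\<bar>)"
    unfolding R_def
  proof (intro order.trans[OF sum_abs] sum_mono)
    fix e assume e: "e \<in> nsets_at V s v"
    have "\<bar>w e * (\<Sum>u\<in>e - {v}. \<Delta> u)\<bar> \<le> \<bar>\<Sum>u\<in>e - {v}. \<Delta> u\<bar>"
      using w'[OF e] by (simp add: abs_mult mult_left_le_one_le)
    thus "\<bar>w e * (\<Sum>u\<in>e - {v}. \<Delta> u)\<bar> \<le> (\<Sum>u\<in>e - {v}. \<bar>\<Delta> u\<bar>)"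
      using sum_abs by (rule order.trans)
  qed
  also have "\<dots> = real ((card V - 2) choose (s - 2)) * (\<Sum>u\<in>V - {v}. \<bar>\<Delta> u\<bar>)"
    by (rule sum_nsets_at_others) fact+
  also have "(\<Sum>u\<in>V - {v}. \<bar>\<Delta> u\<bar>) \<le> (\<Sum>u\<in>V. \<bar>\<Delta> u\<bar>)"
    using V by (intro sum_mono2) auto
  also have "\<dots> \<le> sqrt (real (card V)) * L2_set \<Delta> V" by (rule sum_abs_le_L2_set)
  finally have R: "\<bar>R\<bar> \<le> real ((card V - 2) choose (s - 2)) * (sqrt (real (card V)) * L2_set \<Delta> V)"
    by (simp add: mult_left_mono)
  \<comment> \<open>Multiplying by \<open>\<Delta> v\<close> before taking absolute values exploits
    the sign of \<open>r v * \<Delta> v\<close>; the size of \<open>r v\<close> is not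
    controlled.\<close>
  have "W * (\<Delta> v)\<^sup>2 = (D v - R) * \<Delta> v + r v * \<Delta> v"
    using arg_cong[OF split, of "\<lambda>y. y * \<Delta> v"] by (simp add: power2_eq_square algebra_simps)
  also have "\<dots> \<le> (\<bar>D v\<bar> + \<bar>R\<bar>) * \<bar>\<Delta> v\<bar>"
    using r abs_ge_self[of "(D v - R) * \<Delta> v"]
      mult_right_mono[OF abs_triangle_ineq4[of "D v" R], of "\<bar>\<Delta> v\<bar>"]
    by (simp add: abs_mult)
  finally have "(W * \<bar>\<Delta> v\<bar>) * \<bar>\<Delta> v\<bar> \<le> (\<bar>D v\<bar> + \<bar>R\<bar>) * \<bar>\<Delta> v\<bar>"
    by (simp add: power2_eq_square mult.assoc)
  hence "W * \<bar>\<Delta> v\<bar> \<le> \<bar>D v\<bar> + \<bar>R\<bar>"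
    by (cases "\<Delta> v = 0") auto
  from order.trans[OF this add_left_mono[OF R]] show ?thesis
    by (rule order.trans[OF mult_right_mono[OF W abs_ge_zero]])
qed

section \<open>Concentration of the degrees\<close>

lemma finite_set_Pi_pmf:
  fixes p :: "'a \<Rightarrow> 'b::finite pmf"
  shows "finite F \<Longrightarrow> finite (set_pmf (Pi_pmf F dflt p))"
  by (simp add: set_Pi_pmf finite_PiE_dflt)

text \<open>Finitely many coordinates with finitely many values give finite support, so
  integrability is automatic wherever linearity of expectation is applied.\<close>

lemma integrable_Pi_pmf_finite:
  fixes p :: "'a \<Rightarrow> 'b::finite pmf" and h :: "('a \<Rightarrow> 'b) \<Rightarrow> real"
  shows "finite F \<Longrightarrow> integrable (measure_pmf (Pi_pmf F dflt p)) h"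
  by (intro integrable_measure_pmf_finite finite_set_Pi_pmf)

text \<open>Fubini for one coordinate; it drives the inductions over the index set below.\<close>

lemma expectation_Pi_pmf_insert:
  fixes p :: "'a \<Rightarrow> 'b::finite pmf" and h :: "('a \<Rightarrow> 'b) \<Rightarrow> real"
  assumes "finite F" "x \<notin> F"
  shows "measure_pmf.expectation (Pi_pmf (insert x F) dflt p) h
           = measure_pmf.expectation (p x)
               (\<lambda>y. measure_pmf.expectation (Pi_pmf F dflt p) (\<lambda>f. h (f(x := y))))"
proof -
  have "measure_pmf.expectation (Pi_pmf (insert x F) dflt p) h
          = (\<Sum>y\<in>UNIV. pmf (p x) y *\<^sub>R measure_pmf.expectation
               (map_pmf (\<lambda>f. f(x := y)) (Pi_pmf F dflt p)) h)"
    unfolding Pi_pmf_insert'[OF assms] map_pmf_def[symmetric]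
    using assms by (intro pmf_expectation_bind) (auto simp: finite_set_Pi_pmf)
  also have "\<dots> = measure_pmf.expectation (p x)
               (\<lambda>y. measure_pmf.expectation (Pi_pmf F dflt p) (\<lambda>f. h (f(x := y))))"
    by (subst integral_measure_pmf[of UNIV]) auto
  finally show ?thesis .
qed

text \<open>The assumption on \<open>S\<close> expresses that it depends only on the coordinates in
  \<open>F\<close>. A single layer can thus be studied inside the product over all layers.\<close>

lemma prob_Pi_pmf_subset:
  assumes "finite A" "F \<subseteq> A"
    and "\<And>f. (\<lambda>x. if x \<in> F then f x else dflt) \<in> S \<longleftrightarrow> f \<in> S"
  shows "measure_pmf.prob (Pi_pmf A dflt p) S = measure_pmf.prob (Pi_pmf F dflt p) S"
  unfolding Pi_pmf_subset[OF assms(1,2)] measure_map_pmf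
  by (rule arg_cong[where f = "measure_pmf.prob _"]) (use assms(3) in auto)

text \<open>The linear term has mean zero and the second moment of \<xi> is at most 1. In the
  inductions below \<open>y\<close> is the newly added coordinate, and \<open>A\<close>,
  \<open>B\<close>, \<open>C\<close> do not depend on it.\<close>

lemma expectation_quadratic_centered:
  fixes q :: "'b::finite pmf" and \<xi> :: "'b \<Rightarrow> real"
  assumes \<xi>: "measure_pmf.expectation q \<xi> = 0" "\<And>y. \<bar>\<xi> y\<bar> \<le> 1" and C: "C \<ge> 0"
  shows "measure_pmf.expectation q (\<lambda>y. A + B * \<xi> y + C * (\<xi> y)\<^sup>2) \<le> A + C"
proof -
  have int: "integrable (measure_pmf q) h" for h :: "'b \<Rightarrow> real"
    by (rule integrable_measure_pmf_finite) simp
  have "measure_pmf.expectation q (\<lambda>y. A + B * \<xi> y + C * (\<xi> y)\<^sup>2)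
          = A + C * measure_pmf.expectation q (\<lambda>y. (\<xi> y)\<^sup>2)"
    by (simp add: int \<xi>(1))
  moreover have "measure_pmf.expectation q (\<lambda>y. (\<xi> y)\<^sup>2) \<le> measure_pmf.expectation q (\<lambda>_. 1)"
    by (intro integral_mono int) (use \<xi>(2) in \<open>simp add: abs_square_le_1\<close>)
  ultimately show ?thesis using C by (simp add: mult_left_le)
qed

text \<open>Variances of independent centred summands add up, and each one is at most
  \<open>(a e)^2\<close>.\<close>

lemma expectation_linear_form_square_le:
  fixes p :: "'a \<Rightarrow> 'b::finite pmf" and \<xi> :: "'a \<Rightarrow> 'b \<Rightarrow> real"
  assumes "finite F"
    and \<xi>: "\<And>e. measure_pmf.expectation (p e) (\<xi> e) = 0" "\<And>e y. \<bar>\<xi> e y\<bar> \<le> 1"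
  shows "measure_pmf.expectation (Pi_pmf F dflt p) (\<lambda>f. (\<Sum>e\<in>F. a e * \<xi> e (f e))\<^sup>2) \<le> (\<Sum>e\<in>F. (a e)\<^sup>2)"
  using assms(1)
proof (induction F)
  case (insert g F)
  let ?E = "measure_pmf.expectation (Pi_pmf F dflt p)"
  define L where "L = (\<lambda>f. \<Sum>e\<in>F. a e * \<xi> e (f e))"
  note int = integrable_Pi_pmf_finite[OF insert.hyps(1)]
  have upd: "(\<Sum>e\<in>insert g F. a e * \<xi> e ((f(g := y)) e)) = a g * \<xi> g y + L f" for f y
    unfolding L_def using insert.hyps
    by (simp, intro sum.cong) auto
  have "measure_pmf.expectation (Pi_pmf (insert g F) dflt p) (\<lambda>f. (\<Sum>e\<in>insert g F. a e * \<xi> e (f e))\<^sup>2)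
          = measure_pmf.expectation (p g) (\<lambda>y. ?E (\<lambda>f. (a g * \<xi> g y + L f)\<^sup>2))"
    unfolding expectation_Pi_pmf_insert[OF insert.hyps] upd ..
  also have "\<dots> = measure_pmf.expectation (p g)
      (\<lambda>y. ?E (\<lambda>f. (L f)\<^sup>2) + (2 * a g * ?E L) * \<xi> g y + (a g)\<^sup>2 * (\<xi> g y)\<^sup>2)"
  proof (rule Bochner_Integration.integral_cong[OF refl])
    fix y
    have "?E (\<lambda>f. (a g * \<xi> g y + L f)\<^sup>2)
        = ?E (\<lambda>f. (L f)\<^sup>2 + (2 * a g * \<xi> g y) * L f + (a g)\<^sup>2 * (\<xi> g y)\<^sup>2)"
      by (simp add: power2_eq_square algebra_simps)
    thus "?E (\<lambda>f. (a g * \<xi> g y + L f)\<^sup>2)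
        = ?E (\<lambda>f. (L f)\<^sup>2) + (2 * a g * ?E L) * \<xi> g y + (a g)\<^sup>2 * (\<xi> g y)\<^sup>2"
      by (simp add: int)
  qed
  also have "\<dots> \<le> ?E (\<lambda>f. (L f)\<^sup>2) + (a g)\<^sup>2"
    by (intro expectation_quadratic_centered \<xi>) simp
  also have "\<dots> \<le> (\<Sum>e\<in>insert g F. (a e)\<^sup>2)"
    using insert by (simp add: L_def)
  finally show ?case .
qed simp

text \<open>Ordered pairs are summed, so a symmetric \<open>h\<close> counts every unordered pair
  twice.\<close>

definition offdiag_sum :: "'a set \<Rightarrow> ('a \<Rightarrow> 'a \<Rightarrow> real) \<Rightarrow> real" where
  "offdiag_sum F h = (\<Sum>x\<in>F. \<Sum>y\<in>F - {x}. h x y)"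

lemma offdiag_sum_insert:
  assumes "finite F" "g \<notin> F" "\<And>x y. h x y = h y x"
  shows "offdiag_sum (insert g F) h = offdiag_sum F h + 2 * (\<Sum>y\<in>F. h g y)"
proof -
  have "(\<Sum>y\<in>insert g F - {x}. h x y) = h g x + (\<Sum>y\<in>F - {x}. h x y)" if "x \<in> F" for x
  proof -
    have "insert g F - {x} = insert g (F - {x})" using that assms by auto
    thus ?thesis using assms by simp
  qed
  moreover have "insert g F - {g} = F" using assms by auto
  ultimately show ?thesis
    using assms by (simp add: offdiag_sum_def sum.distrib)
qed

lemma offdiag_sum_eq:
  assumes "finite F"
  shows "offdiag_sum F h = (\<Sum>x\<in>F. \<Sum>y\<in>F. h x y) - (\<Sum>x\<in>F. h x x)"
  using assms by (simp add: offdiag_sum_def sum_diff1 sum_subtractf)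

text \<open>Off the diagonal distinct monomials are uncorrelated, so adding one coordinate increases
  the second moment only by that of the cross term.\<close>
lemma expectation_offdiag_form_square_le:
  fixes p :: "'a \<Rightarrow> 'b::finite pmf" and \<xi> :: "'a \<Rightarrow> 'b \<Rightarrow> real"
  assumes "finite F"
    and \<xi>: "\<And>e. measure_pmf.expectation (p e) (\<xi> e) = 0" "\<And>e y. \<bar>\<xi> e y\<bar> \<le> 1"
    and a: "\<And>x y. a x y = a y x"
  shows "measure_pmf.expectation (Pi_pmf F dflt p)
           (\<lambda>f. (offdiag_sum F (\<lambda>x y. a x y * (\<xi> x (f x) * \<xi> y (f y))))\<^sup>2)
         \<le> 2 * offdiag_sum F (\<lambda>x y. (a x y)\<^sup>2)"
  using assms(1)
proof (induction F)
  case empty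
  show ?case by (simp add: offdiag_sum_def)
next
  case (insert g F)
  let ?E = "measure_pmf.expectation (Pi_pmf F dflt p)"
  let ?T = "\<lambda>F f. offdiag_sum F (\<lambda>x y. a x y * (\<xi> x (f x) * \<xi> y (f y)))"
  define L where "L = (\<lambda>f. \<Sum>e\<in>F. a g e * \<xi> e (f e))"
  note int = integrable_Pi_pmf_finite[OF insert.hyps(1)]
  \<comment> \<open>Only the pairs containing \<open>g\<close> involve \<open>y\<close>, and they do
    so linearly; the factor 2 counts both orders.\<close>
  have upd: "?T (insert g F) (f(g := y)) = ?T F f + 2 * \<xi> g y * L f" for f y
  proof -
    have "?T (insert g F) (f(g := y)) = ?T F (f(g := y))
            + 2 * (\<Sum>e\<in>F. a g e * (\<xi> g ((f(g := y)) g) * \<xi> e ((f(g := y)) e)))"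
      using insert.hyps a by (intro offdiag_sum_insert) auto
    also have "?T F (f(g := y)) = ?T F f"
      unfolding offdiag_sum_def using insert.hyps by (intro sum.cong refl) auto
    also have "(\<Sum>e\<in>F. a g e * (\<xi> g ((f(g := y)) g) * \<xi> e ((f(g := y)) e))) = \<xi> g y * L f"
      unfolding L_def sum_distrib_left using insert.hyps by (intro sum.cong refl) auto
    finally show ?thesis by simp
  qed
  have "measure_pmf.expectation (Pi_pmf (insert g F) dflt p) (\<lambda>f. (?T (insert g F) f)\<^sup>2)
          = measure_pmf.expectation (p g) (\<lambda>y. ?E (\<lambda>f. (?T F f + 2 * \<xi> g y * L f)\<^sup>2))"
    unfolding expectation_Pi_pmf_insert[OF insert.hyps] upd ..
  also have "\<dots> = measure_pmf.expectation (p g)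
      (\<lambda>y. ?E (\<lambda>f. (?T F f)\<^sup>2) + (4 * ?E (\<lambda>f. ?T F f * L f)) * \<xi> g y
             + (4 * ?E (\<lambda>f. (L f)\<^sup>2)) * (\<xi> g y)\<^sup>2)"
  proof (rule Bochner_Integration.integral_cong[OF refl])
    fix y
    have "?E (\<lambda>f. (?T F f + 2 * \<xi> g y * L f)\<^sup>2)
        = ?E (\<lambda>f. (?T F f)\<^sup>2 + (4 * \<xi> g y) * (?T F f * L f) + (4 * (\<xi> g y)\<^sup>2) * (L f)\<^sup>2)"
      by (simp add: power2_eq_square algebra_simps)
    thus "?E (\<lambda>f. (?T F f + 2 * \<xi> g y * L f)\<^sup>2)
        = ?E (\<lambda>f. (?T F f)\<^sup>2) + (4 * ?E (\<lambda>f. ?T F f * L f)) * \<xi> g y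
             + (4 * ?E (\<lambda>f. (L f)\<^sup>2)) * (\<xi> g y)\<^sup>2"
      by (simp add: int)
  qed
  also have "\<dots> \<le> ?E (\<lambda>f. (?T F f)\<^sup>2) + 4 * ?E (\<lambda>f. (L f)\<^sup>2)"
    by (intro expectation_quadratic_centered \<xi>) simp
  also have "?E (\<lambda>f. (L f)\<^sup>2) \<le> (\<Sum>e\<in>F. (a g e)\<^sup>2)"
    unfolding L_def by (intro expectation_linear_form_square_le insert.hyps \<xi>)
  \<comment> \<open>The increment, four times the sum of \<open>(a g e)^2\<close>, is twice the
    growth of the off-diagonal sum of squares, which preserves the constant 2.\<close>
  finally show ?case
    using insert.IH offdiag_sum_insert[OF insert.hyps, of "\<lambda>x y. (a x y)\<^sup>2"] a by simp
qed

section \<open>Euclidean norm of the degree deviations\<close>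

text \<open>A pair of edges contributes once for each common vertex. The squared norm of the degree
  deviations thereby becomes a quadratic form in the edge variables.\<close>

lemma sum_nsets_at_square:
  fixes x :: "'a set \<Rightarrow> real"
  assumes V: "finite V"
  shows "(\<Sum>v\<in>V. (\<Sum>e\<in>nsets_at V s v. x e)\<^sup>2)
           = (\<Sum>e\<in>nsets V s. \<Sum>e'\<in>nsets V s. real (card (e \<inter> e')) * (x e * x e'))"
proof -
  have finE: "finite (nsets V s)" using V by (simp add: finite_imp_finite_nsets)
  have "(\<Sum>v\<in>V. (\<Sum>e\<in>nsets_at V s v. x e)\<^sup>2)
          = (\<Sum>e\<in>nsets V s. x e * (\<Sum>v\<in>e. \<Sum>e'\<in>nsets_at V s v. x e'))"
    unfolding sum_nsets_at_swap[OF V, symmetric] power2_eq_square ..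
  also have "\<dots> = (\<Sum>e\<in>nsets V s. \<Sum>e'\<in>nsets V s. real (card (e \<inter> e')) * (x e * x e'))"
  proof (rule sum.cong[OF refl])
    fix e assume "e \<in> nsets V s"
    hence e: "finite e" by (simp add: nsets_def)
    have "(\<Sum>v\<in>e. \<Sum>e'\<in>nsets_at V s v. x e') = (\<Sum>v\<in>e. \<Sum>e'\<in>nsets V s. if v \<in> e' then x e' else 0)"
      unfolding nsets_at_def sum.inter_filter[OF finE] ..
    also have "\<dots> = (\<Sum>e'\<in>nsets V s. \<Sum>v\<in>e. if v \<in> e' then x e' else 0)" by (rule sum.swap)
    also have "\<dots> = (\<Sum>e'\<in>nsets V s. real (card (e \<inter> e')) * x e')"
      using e by (simp add: sum.inter_restrict[symmetric])
    finally show "x e * (\<Sum>v\<in>e. \<Sum>e'\<in>nsets_at V s v. x e')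
        = (\<Sum>e'\<in>nsets V s. real (card (e \<inter> e')) * (x e * x e'))"
      by (simp add: sum_distrib_left mult_ac)
  qed
  finally show ?thesis .
qed

lemma card_nsets_le_power: "finite V \<Longrightarrow> card (nsets V s) \<le> card V ^ s"
  by (cases "s \<le> card V") (auto simp: card_nsets binomial_le_pow binomial_eq_0)

lemma card_nsets_at_le_power:
  assumes "finite V" "v \<in> V" "s \<ge> 1"
  shows "card (nsets_at V s v) \<le> card V ^ (s - 1)"
proof -
  have "card (nsets_at V s v) = card (nsets (V - {v}) (s - 1))"
    using assms by (simp add: card_nsets_at card_nsets)
  also have "\<dots> \<le> card (V - {v}) ^ (s - 1)" using assms by (intro card_nsets_le_power) simp
  also have "\<dots> \<le> card V ^ (s - 1)" using assms by (intro power_mono card_mono) auto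
  finally show ?thesis .
qed

text \<open>One factor \<open>card (e \<inter> e')\<close> is at most \<open>s\<close>. Summing the
  other counts triples of a vertex and two edges through it, which is the sum of squared vertex
  degrees in the complete \<open>s\<close>-uniform hypergraph.\<close>

lemma offdiag_sum_intersections_le:
  assumes V: "finite V" and s: "s \<ge> 1"
  shows "offdiag_sum (nsets V s) (\<lambda>e e'. (real (card (e \<inter> e')))\<^sup>2)
           \<le> real s * real (card V) ^ (2 * s - 1)"
proof -
  have "offdiag_sum (nsets V s) (\<lambda>e e'. (real (card (e \<inter> e')))\<^sup>2)
          \<le> (\<Sum>e\<in>nsets V s. \<Sum>e'\<in>nsets V s. (real (card (e \<inter> e')))\<^sup>2)"
    using V by (subst offdiag_sum_eq) (auto simp: finite_imp_finite_nsets intro!: sum_nonneg)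
  also have "\<dots> \<le> (\<Sum>e\<in>nsets V s. \<Sum>e'\<in>nsets V s. real s * real (card (e \<inter> e')))"
  proof (intro sum_mono)
    fix e e' assume "e \<in> nsets V s"
    hence "card (e \<inter> e') \<le> s" by (auto simp: nsets_def intro: card_mono)
    thus "(real (card (e \<inter> e')))\<^sup>2 \<le> real s * real (card (e \<inter> e'))"
      by (simp add: power2_eq_square mult_right_mono)
  qed
  also have "\<dots> = real s * (\<Sum>v\<in>V. (real (card (nsets_at V s v)))\<^sup>2)"
    using sum_nsets_at_square[OF V, where s = s and x = "\<lambda>_. 1"] by (simp add: sum_distrib_left)
  also have "\<dots> \<le> real s * (\<Sum>v\<in>V. (real (card V) ^ (s - 1))\<^sup>2)"
  proof (intro mult_left_mono sum_mono power_mono)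
    fix v assume "v \<in> V"
    from card_nsets_at_le_power[OF V this s]
    show "real (card (nsets_at V s v)) \<le> real (card V) ^ (s - 1)"
      by (metis of_nat_le_iff of_nat_power)
  qed auto
  also have "\<dots> = real s * real (card V) ^ (2 * s - 1)"
  proof -
    have "2 * s - 1 = Suc ((s - 1) * 2)" using s by simp
    thus ?thesis by (simp add: power_mult)
  qed
  finally show ?thesis .
qed

text \<open>With \<open>n = card V\<close>, the diagonal takes at most \<open>s * n ^ s\<close> of
  the threshold \<open>(s + 1) * n ^ s\<close>, so exceeding it forces the off-diagonal part above
  \<open>n ^ s\<close>. The second moment of that part is at most
  \<open>2 * s * n ^ (2 * s - 1)\<close>, and Chebyshev's inequality applies.\<close>

lemma prob_degree_deviation_L2:
  fixes p :: "'a set \<Rightarrow> 'b::finite pmf" and \<xi> :: "'a set \<Rightarrow> 'b \<Rightarrow> real"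
  assumes V: "finite V" "V \<noteq> {}" and s: "s \<ge> 1" and A: "finite A" "nsets V s \<subseteq> A"
    and \<xi>: "\<And>e. measure_pmf.expectation (p e) (\<xi> e) = 0" "\<And>e y. \<bar>\<xi> e y\<bar> \<le> 1"
  shows "measure_pmf.prob (Pi_pmf A dflt p)
           {f. L2_set (\<lambda>v. \<Sum>e\<in>nsets_at V s v. \<xi> e (f e)) V > sqrt ((real s + 1) * real (card V) ^ s)}
         \<le> 2 * real s / real (card V)"
proof -
  let ?n = "real (card V)" and ?F = "nsets V s"
  let ?D = "\<lambda>f. L2_set (\<lambda>v. \<Sum>e\<in>nsets_at V s v. \<xi> e (f e)) V"
  let ?T = "\<lambda>f. offdiag_sum ?F (\<lambda>e e'. real (card (e \<inter> e')) * (\<xi> e (f e) * \<xi> e' (f e')))"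
  have finF: "finite ?F" using V by (simp add: finite_imp_finite_nsets)
  have n: "?n > 0" using V by (simp add: card_gt_0_iff)
  have large: "(?n ^ s)\<^sup>2 \<le> (?T f)\<^sup>2" if "?D f > sqrt ((real s + 1) * ?n ^ s)" for f
  proof -
    have "(real s + 1) * ?n ^ s < (\<Sum>v\<in>V. (\<Sum>e\<in>nsets_at V s v. \<xi> e (f e))\<^sup>2)"
      using that by (simp add: L2_set_def)
    also have "\<dots> = ?T f + (\<Sum>e\<in>?F. real (card (e \<inter> e)) * (\<xi> e (f e) * \<xi> e (f e)))"
      unfolding sum_nsets_at_square[OF V(1)] offdiag_sum_eq[OF finF] by simp
    \<comment> \<open>The diagonal is bounded deterministically: squares of \<xi> are at most 1 and
      each edge has \<open>s\<close> vertices.\<close>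
    also have "(\<Sum>e\<in>?F. real (card (e \<inter> e)) * (\<xi> e (f e) * \<xi> e (f e))) \<le> (\<Sum>e\<in>?F. real s * 1)"
    proof (rule sum_mono)
      fix e assume "e \<in> ?F"
      moreover have "\<xi> e (f e) * \<xi> e (f e) \<le> 1"
        using \<xi>(2)[of e "f e"] by (simp add: abs_square_le_1 flip: power2_eq_square)
      ultimately show "real (card (e \<inter> e)) * (\<xi> e (f e) * \<xi> e (f e)) \<le> real s * 1"
        by (intro mult_mono) (auto simp: nsets_def)
    qed
    also have "\<dots> = real s * real (card ?F)" by simp
    also have "\<dots> \<le> real s * ?n ^ s"
      using card_nsets_le_power[OF V(1), of s]
      by (intro mult_left_mono) (metis of_nat_le_iff of_nat_power, simp)
    finally have "?n ^ s \<le> ?T f" by (simp add: algebra_simps)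
    thus ?thesis by (intro power_mono) auto
  qed
  have "measure_pmf.prob (Pi_pmf A dflt p) {f. ?D f > sqrt ((real s + 1) * ?n ^ s)}
          = measure_pmf.prob (Pi_pmf ?F dflt p) {f. ?D f > sqrt ((real s + 1) * ?n ^ s)}"
  proof (rule prob_Pi_pmf_subset[OF A])
    fix f
    have "?D (\<lambda>x. if x \<in> ?F then f x else dflt) = ?D f"
      by (intro L2_set_cong sum.cong refl) (auto simp: nsets_at_def)
    thus "(\<lambda>x. if x \<in> ?F then f x else dflt) \<in> {f. ?D f > sqrt ((real s + 1) * ?n ^ s)}
            \<longleftrightarrow> f \<in> {f. ?D f > sqrt ((real s + 1) * ?n ^ s)}" by simp
  qed
  also have "\<dots> \<le> measure_pmf.prob (Pi_pmf ?F dflt p) {f. (?n ^ s)\<^sup>2 \<le> (?T f)\<^sup>2}"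
    using large by (intro measure_pmf.finite_measure_mono) auto
  also have "\<dots> \<le> measure_pmf.expectation (Pi_pmf ?F dflt p) (\<lambda>f. (?T f)\<^sup>2) / (?n ^ s)\<^sup>2"
    using integral_Markov_inequality_measure[of "measure_pmf (Pi_pmf ?F dflt p)" "\<lambda>f. (?T f)\<^sup>2" "{}" "(?n ^ s)\<^sup>2"]
      n by (simp add: integrable_Pi_pmf_finite[OF finF])
  also have "\<dots> \<le> (2 * (real s * ?n ^ (2 * s - 1))) / (?n ^ s)\<^sup>2"
  proof (rule divide_right_mono)
    show "measure_pmf.expectation (Pi_pmf ?F dflt p) (\<lambda>f. (?T f)\<^sup>2) \<le> 2 * (real s * ?n ^ (2 * s - 1))"
    proof (rule order.trans[OF expectation_offdiag_form_square_le[OF finF \<xi>]])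
      show "2 * offdiag_sum ?F (\<lambda>e e'. (real (card (e \<inter> e')))\<^sup>2) \<le> 2 * (real s * ?n ^ (2 * s - 1))"
        using offdiag_sum_intersections_le[OF V(1) s] by linarith
    qed (simp add: Int_commute)
  qed simp
  also have "\<dots> = 2 * real s / ?n"
  proof -
    have "(?n ^ s)\<^sup>2 = ?n ^ (2 * s - 1) * ?n"
      using s by (simp flip: power_Suc2 power_mult) (simp add: mult.commute)
    thus ?thesis using n by simp
  qed
  finally show ?thesis .
qed

section \<open>Maximum norm of the degree deviations\<close>

lemma prob_Pi_pmf_Hoeffding:
  fixes p :: "'a \<Rightarrow> bool pmf"
  assumes A: "finite A" "F \<subseteq> A" "F \<noteq> {}" and \<epsilon>: "\<epsilon> \<ge> 0"
  shows "measure_pmf.prob (Pi_pmf A dflt p)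
           {f. \<bar>\<Sum>e\<in>F. of_bool (f e) - pmf (p e) True\<bar> \<ge> \<epsilon>} \<le> 2 * exp (- 2 * \<epsilon>\<^sup>2 / real (card F))"
proof -
  let ?P = "Pi_pmf A dflt p"
  have finF: "finite F" using A by (blast intro: finite_subset)
  have mean: "measure_pmf.expectation ?P (\<lambda>f. of_bool (f e)) = pmf (p e) True" if "e \<in> F" for e
  proof -
    have "e \<in> A" using that A by auto
    have "measure_pmf.expectation ?P (\<lambda>f. of_bool (f e))
            = measure_pmf.expectation (map_pmf (\<lambda>f. f e) ?P) (of_bool :: bool \<Rightarrow> real)" by simp
    also have "\<dots> = pmf (p e) True"
      using A \<open>e \<in> A\<close> by (simp add: Pi_pmf_component integral_measure_pmf_real[of UNIV] UNIV_bool)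
    finally show ?thesis .
  qed
  have indep: "prob_space.indep_vars ?P (\<lambda>_. borel) (\<lambda>e f. of_bool (f e) :: real) F"
    by (rule prob_space.indep_vars_compose2[OF measure_pmf.prob_space_axioms
          prob_space.indep_vars_subset[OF measure_pmf.prob_space_axioms indep_vars_Pi_pmf[OF A(1)] A(2)]])
       auto
  \<comment> \<open>All indicators lie between 0 and 1, so the sum of squared ranges in the exponent
    is \<open>card F\<close>.\<close>
  interpret Hoeffding_ineq ?P F "\<lambda>e f. of_bool (f e)" "\<lambda>_. 0" "\<lambda>_. 1" "\<Sum>e\<in>F. pmf (p e) True"
    by unfold_locales (use finF indep in \<open>auto simp: mean\<close>)
  show ?thesis
    using Hoeffding_ineq_abs_ge[OF \<epsilon>] finF A by (simp add: sum_subtractf card_gt_0_iff)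
qed

lemma prob_degree_deviation:
  fixes p :: "'a set \<Rightarrow> bool pmf"
  assumes V: "finite V" and s: "s \<ge> 1" "s \<le> card V" and A: "finite A" "nsets V s \<subseteq> A"
  defines "dev \<equiv> \<lambda>f v. \<Sum>e\<in>nsets_at V s v. of_bool (f e) - pmf (p e) True"
  shows "measure_pmf.prob (Pi_pmf A dflt p)
           {f. \<not> (L2_set (dev f) V \<le> sqrt ((real s + 1) * real (card V) ^ s) \<and>
                  (\<forall>v\<in>V. \<bar>dev f v\<bar> \<le> sqrt (real (card V) ^ (s - 1) * ln (real (card V)))))}
         \<le> (2 * real s + 2) / real (card V)"
proof -
  let ?P = "Pi_pmf A dflt p" and ?n = "real (card V)"
  \<comment> \<open>At most \<open>?n ^ (s - 1)\<close> edges contain a vertex, so at this threshold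
    Hoeffding's exponent is at most \<open>- 2 * ln ?n\<close>. The resulting
    \<open>2 / ?n^2\<close> per vertex leaves \<open>2 / ?n\<close> after the union bound.\<close>
  define t where "t = sqrt (?n ^ (s - 1) * ln ?n)"
  define S where "S = {f. L2_set (dev f) V > sqrt ((real s + 1) * ?n ^ s)}"
  define S' where "S' = (\<lambda>v. {f. \<bar>dev f v\<bar> \<ge> t})"
  have n: "?n \<ge> 1" using s by simp
  have V': "V \<noteq> {}" using s by auto
  have t: "t \<ge> 0" "t\<^sup>2 = ?n ^ (s - 1) * ln ?n" using n by (simp_all add: t_def)
  have S: "measure_pmf.prob ?P S \<le> 2 * real s / ?n"
  proof -
    have "measure_pmf.expectation (p e) (\<lambda>y. of_bool y - pmf (p e) True) = 0" for e
    proof -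
      have "measure_pmf.expectation (p e) (\<lambda>y. of_bool y :: real) = pmf (p e) True"
        by (simp add: integral_measure_pmf_real[of UNIV] UNIV_bool)
      thus ?thesis by (simp add: integrable_measure_pmf_finite)
    qed
    moreover have "\<bar>of_bool y - pmf (p e) True\<bar> \<le> 1" for e y
      using pmf_le_1[of "p e" True] pmf_nonneg[of "p e" True] by (cases y) auto
    ultimately show ?thesis
      unfolding S_def dev_def by (intro prob_degree_deviation_L2 V V' s A) auto
  qed
  have S': "measure_pmf.prob ?P (S' v) \<le> 2 / ?n\<^sup>2" if v: "v \<in> V" for v
  proof -
    let ?N = "real (card (nsets_at V s v))"
    have "card (nsets_at V s v) > 0" using v V s by (simp add: card_nsets_at)
    hence N: "?N > 0" and ne: "nsets_at V s v \<noteq> {}" by auto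
    have Nn: "?N \<le> ?n ^ (s - 1)"
      using card_nsets_at_le_power[OF V v s(1)] by (metis of_nat_le_iff of_nat_power)
    have "measure_pmf.prob ?P (S' v) \<le> 2 * exp (- 2 * t\<^sup>2 / ?N)"
      unfolding S'_def dev_def
      using A ne t by (intro prob_Pi_pmf_Hoeffding) (auto simp: nsets_at_def)
    also have "\<dots> \<le> 2 * exp (- 2 * ln ?n)"
      using mult_right_mono[OF Nn, of "ln ?n"] n N t by (simp add: field_simps)
    also have "exp (- 2 * ln ?n) = 1 / ?n\<^sup>2"
    proof -
      have "exp (- 2 * ln ?n) = inverse (exp (of_nat 2 * ln ?n))" by (simp flip: exp_minus)
      also have "\<dots> = 1 / ?n\<^sup>2" using n by (subst exp_of_nat_mult) (simp add: divide_inverse)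
      finally show ?thesis .
    qed
    finally show ?thesis by simp
  qed
  have "measure_pmf.prob ?P {f. \<not> (L2_set (dev f) V \<le> sqrt ((real s + 1) * ?n ^ s) \<and>
                  (\<forall>v\<in>V. \<bar>dev f v\<bar> \<le> sqrt (?n ^ (s - 1) * ln ?n)))}
          \<le> measure_pmf.prob ?P (S \<union> (\<Union>v\<in>V. S' v))"
    by (intro measure_pmf.finite_measure_mono) (auto simp: S_def S'_def t_def not_le less_imp_le)
  also have "\<dots> \<le> measure_pmf.prob ?P S + (\<Sum>v\<in>V. measure_pmf.prob ?P (S' v))"
    using measure_pmf.finite_measure_subadditive_finite[OF V, of S' ?P]
    by (intro order.trans[OF measure_Un_le]) auto
  also have "\<dots> \<le> 2 * real s / ?n + ?n * (2 / ?n\<^sup>2)"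
    using sum_bounded_above[of V "\<lambda>v. measure_pmf.prob ?P (S' v)" "2 / ?n\<^sup>2"] S S'
    by (intro add_mono) auto
  also have "\<dots> = (2 * real s + 2) / ?n"
    using n by (simp add: power2_eq_square field_simps)
  finally show ?thesis .
qed

section \<open>The logistic function and the likelihood on a box\<close>

definition logistic :: "real \<Rightarrow> real" where
  "logistic x = exp x / (1 + exp x)"

lemma one_plus_exp [simp]: "0 < 1 + exp (x :: real)" "1 + exp (x :: real) \<noteq> 0"
  using exp_gt_zero[of x] by linarith+

lemma logistic_pos: "0 < logistic x" and logistic_less_1: "logistic x < 1"
  by (simp_all add: logistic_def)

lemma has_real_derivative_logistic:
  "(logistic has_real_derivative exp x / (1 + exp x)\<^sup>2) (at x)"
  unfolding logistic_def[abs_def]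
  by (auto intro!: derivative_eq_intros simp: power2_eq_square diff_divide_distrib[symmetric] algebra_simps)

text \<open>\<open>ln (1 + exp x)\<close> is the log-partition function of one edge. Its derivative
  is the edge probability, which makes the gradient of the negative log-likelihood expected minus
  observed degree.\<close>

lemma has_real_derivative_ln_one_plus_exp:
  assumes "(h has_real_derivative D) (at x)"
  shows "((\<lambda>t. ln (1 + exp (h t))) has_real_derivative logistic (h x) * D) (at x)"
proof -
  have "(h has_real_derivative D) (at x within UNIV)" using assms by simp
  from DERIV_ln_divide[OF one_plus_exp(1), of "h x"] this show ?thesis
    by (auto intro!: derivative_eq_intros simp: logistic_def)
qed

text \<open>Since \<open>1 + exp x\<close> is at most twice the larger of \<open>1\<close> and
  \<open>exp x\<close>, the derivative is at least \<open>exp (- \<bar>x\<bar>) / 4\<close>.\<close>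

lemma logistic_deriv_bounds:
  fixes x K :: real
  assumes "\<bar>x\<bar> \<le> K"
  shows "exp (-K) / 4 \<le> exp x / (1 + exp x)\<^sup>2" "exp x / (1 + exp x)\<^sup>2 \<le> 1"
proof -
  have pos: "0 < (1 + exp x)\<^sup>2" by simp
  have "exp (-K) * (1 + exp x)\<^sup>2 \<le> 4 * exp x"
  proof (cases "x \<ge> 0")
    case True
    have "exp (-K) * (1 + exp x)\<^sup>2 \<le> exp (-x) * (exp x + exp x)\<^sup>2"
      using assms True by (intro mult_mono power_mono) auto
    also have "\<dots> = 4 * (exp (-x) * exp x) * exp x" by (simp add: power2_eq_square)
    also have "\<dots> = 4 * exp x" by (simp add: exp_minus)
    finally show ?thesis .
  next
    case False
    have "exp (-K) * (1 + exp x)\<^sup>2 \<le> exp x * (1 + 1)\<^sup>2"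
      using assms False by (intro mult_mono power_mono add_mono) auto
    thus ?thesis by simp
  qed
  with pos show "exp (-K) / 4 \<le> exp x / (1 + exp x)\<^sup>2" by (simp add: field_simps)
  have "exp x \<le> (1 + exp x)\<^sup>2" by (simp add: power2_eq_square algebra_simps)
  with pos show "exp x / (1 + exp x)\<^sup>2 \<le> 1" by simp
qed

lemma strict_mono_logistic: "strict_mono logistic"
proof (rule strict_monoI)
  fix x y :: real
  assume "x < y"
  moreover have "\<exists>d. (logistic has_real_derivative d) (at z) \<and> 0 < d" for z
    using has_real_derivative_logistic[of z]
    by (intro exI[of _ "exp z / (1 + exp z)\<^sup>2"]) (auto simp: zero_less_divide_iff)
  ultimately show "logistic x < logistic y"
    using DERIV_pos_imp_increasing[of x y logistic] by blast
qed

text \<open>Mean value theorem in a form without a quotient, so that edges with \<open>x = y\<close>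
  also receive a weight.\<close>

lemma logistic_diff:
  assumes "\<bar>x\<bar> \<le> K" "\<bar>y\<bar> \<le> K"
  shows "\<exists>w. exp (-K) / 4 \<le> w \<and> w \<le> 1 \<and> logistic x - logistic y = w * (x - y)"
proof -
  have *: "\<exists>w. exp (-K) / 4 \<le> w \<and> w \<le> 1 \<and> logistic x - logistic y = w * (x - y)"
    if xy: "x < y" "\<bar>x\<bar> \<le> K" "\<bar>y\<bar> \<le> K" for x y
  proof -
    obtain z where z: "x < z" "z < y"
        "logistic y - logistic x = (y - x) * (exp z / (1 + exp z)\<^sup>2)"
      using MVT2[OF xy(1) has_real_derivative_logistic] by blast
    with xy have "\<bar>z\<bar> \<le> K" by linarith
    define w where "w = exp z / (1 + exp z)\<^sup>2"
    have "logistic x - logistic y = w * (x - y)"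
      using z(3) by (simp add: w_def[symmetric] algebra_simps)
    with logistic_deriv_bounds[OF \<open>\<bar>z\<bar> \<le> K\<close>] show ?thesis
      unfolding w_def by blast
  qed
  consider "x < y" | "y < x" | "x = y" by linarith
  thus ?thesis
  proof cases
    case 2
    from *[OF this assms(2,1)] show ?thesis by (metis minus_diff_eq mult_minus_right)
  next
    case 3
    \<comment> \<open>For \<open>x = y\<close> the weight 1 is taken; it is admissible because
      \<open>K \<ge> 0\<close>.\<close>
    have "exp (-K) \<le> exp 0" using assms by (subst exp_le_cancel_iff) simp
    hence "exp (-K) / 4 \<le> 1" unfolding exp_zero by linarith
    with 3 show ?thesis by (intro exI[of _ 1]) simp
  qed (use * assms in blast)
qed

section \<open>Box-constrained minimisation and uniqueness\<close>

text \<open>Away from the right end a small step right cannot decrease \<open>g\<close>, so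
  \<open>r \<ge> 0\<close>; away from the left end likewise \<open>r \<le> 0\<close>. At an end
  point only the inequality pointing out of the interval is lost.\<close>

lemma interval_minimum_deriv_sign:
  fixes g :: "real \<Rightarrow> real"
  assumes g: "(g has_real_derivative r) (at x)" and x: "\<bar>x - a\<bar> \<le> 1"
    and min: "\<And>t. \<bar>t - a\<bar> \<le> 1 \<Longrightarrow> g x \<le> g t"
  shows "r * (x - a) \<le> 0" "\<bar>x - a\<bar> < 1 \<Longrightarrow> r = 0"
proof -
  have ge: "0 \<le> r" if "x < a + 1"
  proof (rule ccontr)
    assume "\<not> 0 \<le> r"
    then obtain \<delta> where \<delta>: "\<delta> > 0" "\<And>h. h > 0 \<Longrightarrow> h < \<delta> \<Longrightarrow> g (x + h) < g x"
      using DERIV_neg_dec_right[OF g] by auto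
    \<comment> \<open>Halving \<delta> keeps the step strictly below it; the second term keeps it
      inside the interval.\<close>
    define h where "h = min (\<delta> / 2) (a + 1 - x)"
    have "h > 0" "h < \<delta>" using \<delta> that by (auto simp: h_def min_def)
    moreover have "\<bar>x + h - a\<bar> \<le> 1" using x \<open>h > 0\<close> by (auto simp: h_def min_def)
    ultimately show False using \<delta>(2)[of h] min[of "x + h"] by auto
  qed
  have le: "r \<le> 0" if "a - 1 < x"
  proof (rule ccontr)
    assume "\<not> r \<le> 0"
    then obtain \<delta> where \<delta>: "\<delta> > 0" "\<And>h. h > 0 \<Longrightarrow> h < \<delta> \<Longrightarrow> g (x - h) < g x"
      using DERIV_pos_inc_left[OF g] by auto
    define h where "h = min (\<delta> / 2) (x - (a - 1))"
    have "h > 0" "h < \<delta>" using \<delta> that by (auto simp: h_def min_def)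
    moreover have "\<bar>x - h - a\<bar> \<le> 1" using x \<open>h > 0\<close> by (auto simp: h_def min_def)
    ultimately show False using \<delta>(2)[of h] min[of "x - h"] by auto
  qed
  show "\<bar>x - a\<bar> < 1 \<Longrightarrow> r = 0" using ge le by linarith
  show "r * (x - a) \<le> 0"
    using ge le by (cases "x \<ge> a") (auto simp: mult_nonpos_nonneg mult_nonneg_nonpos)
qed

text \<open>
  The Karush-Kuhn-Tucker conditions for the minimiser of the negative log-likelihood over the box
  of radius 1 around \<open>\<beta>\<close>, where \<open>r\<close> is the gradient.
\<close>
lemma box_likelihood_minimizer:
  fixes \<beta> d :: "'a \<Rightarrow> real"
  assumes V: "finite V"
  obtains b r where
    "\<And>v. v \<in> V \<Longrightarrow> \<bar>b v - \<beta> v\<bar> \<le> 1"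
    "\<And>v. v \<in> V \<Longrightarrow> (\<Sum>e\<in>nsets_at V s v. logistic (\<Sum>u\<in>e. b u)) = d v + r v"
    "\<And>v. v \<in> V \<Longrightarrow> r v * (b v - \<beta> v) \<le> 0"
    "\<And>v. v \<in> V \<Longrightarrow> \<bar>b v - \<beta> v\<bar> < 1 \<Longrightarrow> r v = 0"
proof -
  have finE: "finite (nsets V s)" using V by (simp add: finite_imp_finite_nsets)
  \<comment> \<open>The negative log-likelihood with observed degrees \<open>d\<close>.\<close>
  define f where "f = (\<lambda>b. (\<Sum>e\<in>nsets V s. ln (1 + exp (\<Sum>u\<in>e. b u))) - (\<Sum>u\<in>V. d u * b u))"
  \<comment> \<open>Coordinates outside \<open>V\<close> are frozen at 0, so the box is a product of
    compact sets over the whole type and is compact in the product topology.\<close>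
  define S where "S = (\<Pi>\<^sub>E v\<in>UNIV. if v \<in> V then {\<beta> v - 1..\<beta> v + 1} else {0})"
  have "compactin (product_topology (\<lambda>_. euclidean) UNIV) S"
    unfolding S_def compactin_PiE by (auto simp: compactin_euclidean_iff)
  hence "compact S"
    by (simp add: euclidean_product_topology compactin_euclidean_iff)
  moreover have "(\<lambda>v. if v \<in> V then \<beta> v else 0) \<in> S"
    by (auto simp: S_def)
  moreover have "continuous_on S f"
  proof -
    have coord: "continuous_on S (\<lambda>b. b u)" for u
      by (rule continuous_on_subset[OF continuous_on_product_coordinates]) auto
    show ?thesis unfolding f_def
      by (intro continuous_intros coord) auto
  qed
  ultimately have "\<exists>b\<in>S. \<forall>y\<in>S. f b \<le> f y"
    by (intro continuous_attains_inf) auto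
  then obtain b where bS: "b \<in> S" and min: "\<And>y. y \<in> S \<Longrightarrow> f b \<le> f y"
    by blast
  define r where "r = (\<lambda>v. (\<Sum>e\<in>nsets_at V s v. logistic (\<Sum>u\<in>e. b u)) - d v)"
  have box: "\<bar>b v - \<beta> v\<bar> \<le> 1" if "v \<in> V" for v
    using PiE_mem[OF bS[unfolded S_def], of v] that by auto
  have deriv: "((\<lambda>t. f (b(v := t))) has_real_derivative r v) (at (b v))" if v: "v \<in> V" for v
  proof -
    have coord: "((\<lambda>t. (b(v := t)) u) has_real_derivative (if u = v then 1 else 0)) (at (b v))" for u
      by auto
    have lin: "((\<lambda>t. \<Sum>u\<in>e. (b(v := t)) u) has_real_derivative (if v \<in> e then 1 else 0)) (at (b v))"
      if "e \<in> nsets V s" for e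
    proof -
      have "((\<lambda>t. \<Sum>u\<in>e. (b(v := t)) u) has_real_derivative (\<Sum>u\<in>e. if u = v then 1 else 0)) (at (b v))"
        by (intro DERIV_sum coord)
      thus ?thesis using that by (simp add: nsets_def)
    qed
    have "((\<lambda>t. ln (1 + exp (\<Sum>u\<in>e. (b(v := t)) u))) has_real_derivative
             (if v \<in> e then logistic (\<Sum>u\<in>e. b u) else 0)) (at (b v))"
      if "e \<in> nsets V s" for e
      using has_real_derivative_ln_one_plus_exp[OF lin[OF that]] by (simp split: if_splits)
    hence "((\<lambda>t. \<Sum>e\<in>nsets V s. ln (1 + exp (\<Sum>u\<in>e. (b(v := t)) u))) has_real_derivative
        (\<Sum>e\<in>nsets V s. if v \<in> e then logistic (\<Sum>u\<in>e. b u) else 0)) (at (b v))"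
      by (intro DERIV_sum)
    moreover have "((\<lambda>t. \<Sum>u\<in>V. d u * (b(v := t)) u) has_real_derivative
        (\<Sum>u\<in>V. d u * (if u = v then 1 else 0))) (at (b v))"
      by (intro DERIV_sum DERIV_cmult coord)
    ultimately have "((\<lambda>t. f (b(v := t))) has_real_derivative
        (\<Sum>e\<in>nsets V s. if v \<in> e then logistic (\<Sum>u\<in>e. b u) else 0)
          - (\<Sum>u\<in>V. d u * (if u = v then 1 else 0))) (at (b v))"
      unfolding f_def by (rule DERIV_diff)
    thus ?thesis
      using V v by (simp add: r_def nsets_at_def sum.inter_filter[OF finE] if_distrib cong: if_cong)
  qed
  \<comment> \<open>Changing one coordinate within its interval stays in the box, so the minimiser
    is minimal along each coordinate line.\<close>
  have min_coord: "f (b(v := b v)) \<le> f (b(v := t))" if "v \<in> V" "\<bar>t - \<beta> v\<bar> \<le> 1" for v t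
  proof -
    have "b(v := t) \<in> S"
      using bS that unfolding S_def PiE_UNIV_domain Pi_iff by (auto simp: abs_le_iff split: if_splits)
    thus ?thesis using min by simp
  qed
  show ?thesis
  proof (rule that[of b r])
    fix v assume v: "v \<in> V"
    show "\<bar>b v - \<beta> v\<bar> \<le> 1" by (rule box[OF v])
    show "(\<Sum>e\<in>nsets_at V s v. logistic (\<Sum>u\<in>e. b u)) = d v + r v" by (simp add: r_def)
    note * = interval_minimum_deriv_sign[OF deriv[OF v] box[OF v] min_coord[OF v]]
    show "r v * (b v - \<beta> v) \<le> 0" by (rule *)
    show "\<bar>b v - \<beta> v\<bar> < 1 \<Longrightarrow> r v = 0" by (rule *)
  qed
qed

text \<open>Pairing the difference of the two systems with \<open>a - b\<close> gives a vanishing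
  sum of terms that are nonnegative by monotonicity. So \<open>a - b\<close> sums to 0 over each
  edge, and the quadratic form bound forces it to vanish; \<open>s + 1 \<le> card V\<close> makes
  the binomial coefficient positive.\<close>

lemma likelihood_solution_unique:
  fixes a b :: "'a \<Rightarrow> real"
  assumes V: "finite V" and s: "s \<ge> 2" and n: "s + 1 \<le> card V"
    and eq: "\<And>v. v \<in> V \<Longrightarrow> (\<Sum>e\<in>nsets_at V s v. logistic (\<Sum>u\<in>e. a u))
                           = (\<Sum>e\<in>nsets_at V s v. logistic (\<Sum>u\<in>e. b u))"
    and v: "v \<in> V"
  shows "a v = b v"
proof -
  let ?g = "\<lambda>e. (logistic (\<Sum>u\<in>e. a u) - logistic (\<Sum>u\<in>e. b u)) * (\<Sum>u\<in>e. a u - b u)"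
  have finE: "finite (nsets V s)" using V by (simp add: finite_imp_finite_nsets)
  have mono: "?g e \<ge> 0" "?g e = 0 \<Longrightarrow> (\<Sum>u\<in>e. a u - b u) = 0" for e
    using strict_monoD[OF strict_mono_logistic, of "\<Sum>u\<in>e. a u" "\<Sum>u\<in>e. b u"]
      strict_monoD[OF strict_mono_logistic, of "\<Sum>u\<in>e. b u" "\<Sum>u\<in>e. a u"]
    by (cases "\<Sum>u\<in>e. a u" "\<Sum>u\<in>e. b u" rule: linorder_cases;
        force simp: sum_subtractf mult_nonpos_nonpos)+
  have "(\<Sum>e\<in>nsets V s. ?g e) = 0"
    unfolding sum_nsets_at_swap[OF V, symmetric] by (simp add: sum_subtractf eq)
  hence "(\<Sum>u\<in>e. a u - b u) = 0" if "e \<in> nsets V s" for e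
    using that mono sum_nonneg_eq_0_iff[OF finE, of ?g] by blast
  hence "real ((card V - 2) choose (s - 1)) * (\<Sum>v\<in>V. (a v - b v)\<^sup>2) \<le> 0"
    using sum_nsets_square_ge[OF V s, of "\<lambda>v. a v - b v"] n s by simp
  moreover have "real ((card V - 2) choose (s - 1)) > 0" using n s by simp
  ultimately have "(\<Sum>v\<in>V. (a v - b v)\<^sup>2) \<le> 0" by (simp add: mult_le_0_iff)
  hence "(\<Sum>v\<in>V. (a v - b v)\<^sup>2) = 0" by (simp add: sum_nonneg order.antisym)
  thus ?thesis using V v by (simp add: sum_nonneg_eq_0_iff)
qed

section \<open>Existence with a priori bounds\<close>

text \<open>
  A lower bound for the derivative of \<open>logistic\<close> at all sums of \<open>s\<close> numbers of absolute value at
  most \<open>\<bar>M\<bar> + 1\<close>.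
\<close>
definition mle_curvature :: "nat \<Rightarrow> real \<Rightarrow> real" where
  "mle_curvature s M = exp (- (real s * (\<bar>M\<bar> + 1))) / 4"

text \<open>The factor \<open>(2 * s) ^ (s - 1)\<close> comes from comparing a binomial coefficient with \<open>n ^ (s - 1)\<close>.\<close>
definition mle_L2_const :: "nat \<Rightarrow> real \<Rightarrow> real" where
  "mle_L2_const s M = (2 * real s) ^ (s - 1) * sqrt (real s + 1) / mle_curvature s M"

text \<open>In \<open>1 + mle_L2_const s M\<close> the 1 accounts for the degree deviation at the
  vertex itself, the other summand for the coupling to the remaining coordinates.\<close>

definition mle_linf_const :: "nat \<Rightarrow> real \<Rightarrow> real" where
  "mle_linf_const s M = (2 * real s) ^ (s - 1) * (1 + mle_L2_const s M) / mle_curvature s M"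

lemma mle_curvature_pos: "mle_curvature s M > 0"
  by (simp add: mle_curvature_def)

lemma mle_L2_const_pos: "mle_L2_const s M > 0"
  using mle_curvature_pos[of s M] by (cases "s = 0") (simp_all add: mle_L2_const_def)

lemmas mle_L2_const_nonneg = less_imp_le[OF mle_L2_const_pos]

lemma mle_linf_const_pos: "mle_linf_const s M > 0"
  using mle_curvature_pos[of s M] mle_L2_const_pos[of s M]
  by (cases "s = 0") (simp_all add: mle_linf_const_def add_pos_pos)

text \<open>Here \<open>n \<le> 2 * (n - 2)\<close>, so
  \<open>n / (2 * s) \<le> (n - 2) / (s - 1)\<close>, and \<open>m choose k\<close> is at least
  \<open>(m / k) ^ k\<close>.\<close>

lemma choose_ge_power:
  assumes "s \<ge> 2" "n \<ge> 2 * s"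
  shows "real n ^ (s - 1) \<le> (2 * real s) ^ (s - 1) * real ((n - 2) choose (s - 1))"
proof -
  have "real n / (2 * real s) \<le> real (n - 2) / real (s - 1)"
  proof -
    have "real n * real (s - 1) \<le> real n * real s" by (simp add: mult_left_mono)
    also have "\<dots> \<le> 2 * real s * real (n - 2)"
      using assms mult_left_mono[of "real n" "2 * real (n - 2)" "real s"]
      by (simp add: of_nat_diff mult.commute mult.assoc)
    finally show ?thesis using assms by (simp add: divide_simps mult.commute)
  qed
  hence "(real n / (2 * real s)) ^ (s - 1) \<le> (real (n - 2) / real (s - 1)) ^ (s - 1)"
    by (intro power_mono) auto
  also have "\<dots> \<le> real ((n - 2) choose (s - 1))"
    using assms by (intro binomial_ge_n_over_k_pow_k) auto
  finally show ?thesis using assms by (simp add: power_divide divide_simps mult.commute)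
qed

text \<open>Each identity extracts \<open>n ^ (s - 1)\<close>, the order of the curvature of the
  likelihood, which then cancels and leaves the stated rates.\<close>

lemma sqrt_power_split:
  assumes "s \<ge> 2" "n > 0"
  shows "sqrt (real n ^ s) = real n ^ (s - 1) * sqrt (1 / real n ^ (s - 2))"
    and "real n ^ (s - 2) * (sqrt (real n) * sqrt (1 / real n ^ (s - 2)))
           = real n ^ (s - 1) * sqrt (1 / real n ^ (s - 1))"
    and "sqrt (real n ^ (s - 1) * x) = real n ^ (s - 1) * sqrt (x / real n ^ (s - 1))"
proof -
  obtain k where s: "s = Suc (Suc k)" using assms by (metis Suc_le_D numeral_2_eq_2 Suc_le_mono)
  have n: "real n > 0" using assms by simp
  have root: "a * sqrt b = sqrt (a\<^sup>2 * b)" if "a \<ge> 0" for a b :: real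
    using that by (simp add: real_sqrt_mult)
  show "sqrt (real n ^ s) = real n ^ (s - 1) * sqrt (1 / real n ^ (s - 2))"
    using n by (subst root) (simp_all add: s power2_eq_square field_simps)
  show "real n ^ (s - 2) * (sqrt (real n) * sqrt (1 / real n ^ (s - 2)))
           = real n ^ (s - 1) * sqrt (1 / real n ^ (s - 1))"
    using n by (subst real_sqrt_mult[symmetric], subst (1 2) root)
      (simp_all add: s power2_eq_square field_simps)
  show "sqrt (real n ^ (s - 1) * x) = real n ^ (s - 1) * sqrt (x / real n ^ (s - 1))"
    using n by (subst root) (simp_all add: power2_eq_square field_simps)
qed

text \<open>Both estimates are proved for the box minimiser while the multiplier \<open>r\<close> is
  still present, which avoids circularity. Only then does \<open>small\<close> show that the box
  constraint is inactive.\<close>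

lemma likelihood_solution_exists:
  fixes \<beta> d :: "'a \<Rightarrow> real"
  assumes V: "finite V" and s: "s \<ge> 2" and n: "card V = n" "n \<ge> 2 * s"
    and \<beta>: "\<And>v. v \<in> V \<Longrightarrow> \<bar>\<beta> v\<bar> \<le> M"
    and D2: "L2_set (\<lambda>v. d v - (\<Sum>e\<in>nsets_at V s v. logistic (\<Sum>u\<in>e. \<beta> u))) V
               \<le> sqrt ((real s + 1) * real n ^ s)"
    and Dinf: "\<And>v. v \<in> V \<Longrightarrow> \<bar>d v - (\<Sum>e\<in>nsets_at V s v. logistic (\<Sum>u\<in>e. \<beta> u))\<bar>
               \<le> sqrt (real n ^ (s - 1) * ln (real n))"
    and small: "mle_linf_const s M * sqrt (ln (real n) / real n ^ (s - 1)) < 1"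
  obtains b where
    "\<And>v. v \<in> V \<Longrightarrow> (\<Sum>e\<in>nsets_at V s v. logistic (\<Sum>u\<in>e. b u)) = d v"
    "L2_set (\<lambda>v. b v - \<beta> v) V \<le> mle_L2_const s M * sqrt (1 / real n ^ (s - 2))"
    "\<And>v. v \<in> V \<Longrightarrow> \<bar>b v - \<beta> v\<bar> \<le> mle_linf_const s M * sqrt (ln (real n) / real n ^ (s - 1))"
proof -
  define D where "D = (\<lambda>v. d v - (\<Sum>e\<in>nsets_at V s v. logistic (\<Sum>u\<in>e. \<beta> u)))"
  define c where "c = mle_curvature s M"
  define \<kappa> where "\<kappa> = (2 * real s) ^ (s - 1)"
  define p where "p = real n ^ (s - 1)"
  define \<rho> where "\<rho> = sqrt (1 / real n ^ (s - 2))"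
  define \<mu> where "\<mu> = sqrt (ln (real n) / real n ^ (s - 1))"
  have n0: "n > 0" and n3: "n \<ge> 3" using n s by auto
  have pos: "c > 0" "\<kappa> > 0" "p > 0" "\<rho> \<ge> 0" "\<mu> \<ge> 0"
    using mle_curvature_pos s n0 by (auto simp: c_def \<kappa>_def p_def \<rho>_def \<mu>_def)
  obtain b r where box: "\<And>v. v \<in> V \<Longrightarrow> \<bar>b v - \<beta> v\<bar> \<le> 1"
    and eq: "\<And>v. v \<in> V \<Longrightarrow> (\<Sum>e\<in>nsets_at V s v. logistic (\<Sum>u\<in>e. b u)) = d v + r v"
    and sgn: "\<And>v. v \<in> V \<Longrightarrow> r v * (b v - \<beta> v) \<le> 0"
    and int: "\<And>v. v \<in> V \<Longrightarrow> \<bar>b v - \<beta> v\<bar> < 1 \<Longrightarrow> r v = 0"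
    using box_likelihood_minimizer[OF V, of \<beta> s d] by blast
  define \<Delta> where "\<Delta> = (\<lambda>v. b v - \<beta> v)"
  have "\<exists>w. c \<le> w \<and> w \<le> 1 \<and>
          logistic (\<Sum>u\<in>e. b u) - logistic (\<Sum>u\<in>e. \<beta> u) = w * (\<Sum>u\<in>e. \<Delta> u)"
    if e: "e \<in> nsets V s" for e
  proof -
    \<comment> \<open>Edge sums of both \<beta> and \<open>b\<close> obey this bound, so the mean
      value weights are at least \<open>c\<close>.\<close>
    have bound: "\<bar>\<Sum>u\<in>e. x u\<bar> \<le> real s * (\<bar>M\<bar> + 1)"
      if "\<And>u. u \<in> V \<Longrightarrow> \<bar>x u\<bar> \<le> \<bar>M\<bar> + 1" for x :: "'a \<Rightarrow> real"
    proof -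
      have "\<bar>\<Sum>u\<in>e. x u\<bar> \<le> (\<Sum>u\<in>e. \<bar>x u\<bar>)" by (rule sum_abs)
      also have "\<dots> \<le> real (card e) * (\<bar>M\<bar> + 1)"
        using that e by (intro sum_bounded_above) (auto simp: nsets_def)
      finally show ?thesis using e by (simp add: nsets_def)
    qed
    have "\<bar>\<beta> u\<bar> \<le> \<bar>M\<bar> + 1" "\<bar>b u\<bar> \<le> \<bar>M\<bar> + 1" if "u \<in> V" for u
      using \<beta>[OF that] box[OF that] by linarith+
    from logistic_diff[OF bound[of b] bound[of \<beta>]] this show ?thesis
      by (simp add: c_def mle_curvature_def \<Delta>_def sum_subtractf)
  qed
  then obtain w where w: "\<And>e. e \<in> nsets V s \<Longrightarrow> c \<le> w e \<and> w e \<le> 1"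
    and w_eq: "\<And>e. e \<in> nsets V s \<Longrightarrow>
          logistic (\<Sum>u\<in>e. b u) - logistic (\<Sum>u\<in>e. \<beta> u) = w e * (\<Sum>u\<in>e. \<Delta> u)"
    by metis
  have sys: "(\<Sum>e\<in>nsets_at V s v. w e * (\<Sum>u\<in>e. \<Delta> u)) = D v + r v" if "v \<in> V" for v
  proof -
    have "(\<Sum>e\<in>nsets_at V s v. w e * (\<Sum>u\<in>e. \<Delta> u))
        = (\<Sum>e\<in>nsets_at V s v. logistic (\<Sum>u\<in>e. b u) - logistic (\<Sum>u\<in>e. \<beta> u))"
      by (intro sum.cong[OF refl]) (auto simp: w_eq nsets_at_def)
    thus ?thesis using eq[OF that] by (simp add: D_def sum_subtractf)
  qed
  have sgn': "r v * \<Delta> v \<le> 0" if "v \<in> V" for v using sgn[OF that] by (simp add: \<Delta>_def)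
  have choose: "p \<le> \<kappa> * real ((n - 2) choose (s - 1))"
    using choose_ge_power[OF s n(2)] by (simp add: p_def \<kappa>_def)
  have L2: "L2_set \<Delta> V \<le> mle_L2_const s M * \<rho>"
  proof -
    have "c * (p * L2_set \<Delta> V) \<le> \<kappa> * (c * real ((n - 2) choose (s - 1)) * L2_set \<Delta> V)"
      using mult_right_mono[OF choose, of "c * L2_set \<Delta> V"] pos
      by (simp add: L2_set_nonneg mult_ac)
    also have "\<dots> \<le> \<kappa> * L2_set D V"
    proof (rule mult_left_mono[OF weighted_system_L2_bound[of V s c w \<Delta> D r, unfolded n(1)]])
      show "2 \<le> n" "0 \<le> c" "0 \<le> \<kappa>" using n3 pos by auto
      show "c \<le> w e" if "e \<in> nsets V s" for e using w[OF that] by blast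
    qed (rule V s sys sgn' | assumption)+
    also have "\<dots> \<le> \<kappa> * (sqrt (real s + 1) * (p * \<rho>))"
      using D2 pos sqrt_power_split(1)[OF s n0]
      by (intro mult_left_mono) (auto simp: D_def real_sqrt_mult p_def \<rho>_def)
    also have "\<dots> = c * (p * (mle_L2_const s M * \<rho>))"
      using pos(1) by (simp add: mle_L2_const_def c_def[symmetric] \<kappa>_def)
    finally show ?thesis using pos by simp
  qed
  \<comment> \<open>As \<open>n \<ge> 3\<close> exceeds \<open>exp 1\<close>,
    \<open>ln n \<ge> 1\<close>, so the coupling term of order \<open>sqrt (1 / p)\<close> is
    absorbed into the logarithmic rate.\<close>
  have \<mu>1: "sqrt (1 / p) \<le> \<mu>"
  proof -
    have "exp 1 \<le> real n" using exp_le n3 by linarith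
    hence "1 \<le> ln (real n)" using n0 by (simp add: ln_ge_iff)
    thus ?thesis unfolding \<mu>_def p_def by (intro real_sqrt_le_mono divide_right_mono) auto
  qed
  have Linf: "\<bar>\<Delta> v\<bar> \<le> mle_linf_const s M * \<mu>" if v: "v \<in> V" for v
  proof -
    have "(n - 2) choose (s - 1) \<le> (n - 1) choose (s - 1)" by (rule binomial_right_mono) simp
    hence "\<kappa> * real ((n - 2) choose (s - 1)) \<le> \<kappa> * real ((n - 1) choose (s - 1))"
      using pos by simp
    with choose have "p \<le> \<kappa> * real ((n - 1) choose (s - 1))" by linarith
    from mult_right_mono[OF this, of "c * \<bar>\<Delta> v\<bar>"]
    have "c * (p * \<bar>\<Delta> v\<bar>) \<le> \<kappa> * (c * real ((n - 1) choose (s - 1)) * \<bar>\<Delta> v\<bar>)"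
      using pos by (simp add: mult_ac)
    also have "\<dots> \<le> \<kappa> * (\<bar>D v\<bar> + real ((n - 2) choose (s - 2)) * (sqrt (real n) * L2_set \<Delta> V))"
      by (rule mult_left_mono[OF weighted_system_row_bound[of V s c w v \<Delta> D r, unfolded n(1),
            OF V s less_imp_le[OF pos(1)] w v sys[OF v] sgn'[OF v]] less_imp_le[OF pos(2)]])
    also have "\<dots> \<le> \<kappa> * (p * \<mu> + real n ^ (s - 2) * (sqrt (real n) * (mle_L2_const s M * \<rho>)))"
    proof (intro mult_left_mono add_mono mult_mono)
      show "\<bar>D v\<bar> \<le> p * \<mu>"
        using Dinf[OF v] sqrt_power_split(3)[OF s n0] by (simp add: D_def p_def \<mu>_def)
      have "(n - 2) choose (s - 2) \<le> (n - 2) ^ (s - 2)" using n by (intro binomial_le_pow) auto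
      also have "\<dots> \<le> n ^ (s - 2)" by (intro power_mono) auto
      finally show "real ((n - 2) choose (s - 2)) \<le> real n ^ (s - 2)"
        by (metis of_nat_le_iff of_nat_power)
    qed (use L2 pos mle_L2_const_nonneg in \<open>auto simp: L2_set_nonneg\<close>)
    also have "\<dots> = \<kappa> * (p * \<mu> + mle_L2_const s M * (p * sqrt (1 / p)))"
      using sqrt_power_split(2)[OF s n0] by (simp add: p_def \<rho>_def mult.left_commute)
    also have "\<dots> \<le> \<kappa> * (p * \<mu> + mle_L2_const s M * (p * \<mu>))"
      using \<mu>1 pos mle_L2_const_nonneg[of s M]
      by (intro mult_left_mono add_left_mono) auto
    also have "\<dots> = c * (p * (mle_linf_const s M * \<mu>))"
    proof -
      have "c * mle_linf_const s M = \<kappa> * (1 + mle_L2_const s M)"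
        using pos(1) by (simp add: mle_linf_const_def c_def[symmetric] \<kappa>_def)
      from arg_cong[OF this, of "\<lambda>y. y * (p * \<mu>)"] show ?thesis
        by (simp add: algebra_simps)
    qed
    finally show ?thesis using pos by simp
  qed
  show ?thesis
  proof (rule that[of b])
    show "L2_set (\<lambda>v. b v - \<beta> v) V \<le> mle_L2_const s M * sqrt (1 / real n ^ (s - 2))"
      using L2 by (simp add: \<Delta>_def \<rho>_def)
  next
    fix v assume v: "v \<in> V"
    show *: "\<bar>b v - \<beta> v\<bar> \<le> mle_linf_const s M * sqrt (ln (real n) / real n ^ (s - 1))"
      using Linf[OF v] by (simp add: \<Delta>_def \<mu>_def)
    \<comment> \<open>By \<open>small\<close> the minimiser is interior in every coordinate, so
      \<open>r v = 0\<close>.\<close>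
    show "(\<Sum>e\<in>nsets_at V s v. logistic (\<Sum>u\<in>e. b u)) = d v"
      using eq[OF v] int[OF v] * small by simp
  qed
qed

section \<open>The layered model\<close>

lemma edge_prob_eq_logistic: "edge_prob b e = logistic (\<Sum>v\<in>e. b v)"
  by (simp add: edge_prob_def logistic_def)

lemma likelihood_eqs_iff:
  "likelihood_eqs r n H Bh \<longleftrightarrow>
     (\<forall>s\<in>{2..r}. \<forall>v\<in>{1..n}.
        (\<Sum>e\<in>nsets_at {1..n} s v. logistic (\<Sum>u\<in>e. Bh s u)) = real (sdegree H s v))"
proof -
  have *: "(\<Sum>T\<in>nsets ({1..n} - {v}) (s - 1).
            exp (Bh s v + (\<Sum>u\<in>T. Bh s u)) / (1 + exp (Bh s v + (\<Sum>u\<in>T. Bh s u))))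
        = (\<Sum>e\<in>nsets_at {1..n} s v. logistic (\<Sum>u\<in>e. Bh s u))"
    if "s \<in> {2..r}" "v \<in> {1..n}" for s v
  proof -
    have "(\<Sum>T\<in>nsets ({1..n} - {v}) (s - 1).
            exp (Bh s v + (\<Sum>u\<in>T. Bh s u)) / (1 + exp (Bh s v + (\<Sum>u\<in>T. Bh s u))))
        = (\<Sum>T\<in>nsets ({1..n} - {v}) (s - 1). logistic (\<Sum>u\<in>insert v T. Bh s u))"
      by (intro sum.cong[OF refl]) (auto simp: nsets_def logistic_def subset_Diff_insert)
    also have "\<dots> = (\<Sum>e\<in>nsets_at {1..n} s v. logistic (\<Sum>u\<in>e. Bh s u))"
      using that by (intro sum_nsets_at) auto
    finally show ?thesis .
  qed
  show ?thesis
    unfolding likelihood_eqs_def by (intro ball_cong refl) (subst *, auto)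
qed

lemma sdegree_eq_sum:
  assumes "s \<in> {2..r}"
  shows "real (sdegree {e \<in> potential_edges r n. f e} s v)
           = (\<Sum>e\<in>nsets_at {1..n} s v. of_bool (f e))"
proof -
  have "{e \<in> {e \<in> potential_edges r n. f e}. card e = s \<and> v \<in> e} = nsets_at {1..n} s v \<inter> {e. f e}"
    using assms by (auto simp: potential_edges_def nsets_at_def nsets_def)
  thus ?thesis by (simp add: sdegree_def)
qed

text \<open>The bounds are imposed on every solution, which avoids naming the unique one.\<close>

definition mle_event :: "nat \<Rightarrow> nat \<Rightarrow> real \<Rightarrow> (nat \<Rightarrow> nat \<Rightarrow> real) \<Rightarrow> nat set set set" where
  "mle_event r n M B =
     {H. (\<exists>!Bh. Bh \<in> param_space r n \<and> likelihood_eqs r n H Bh) \<and>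
         (\<forall>Bh \<in> param_space r n. likelihood_eqs r n H Bh \<longrightarrow>
            (\<forall>s\<in>{2..r}.
               L2_set (\<lambda>v. Bh s v - B s v) {1..n} \<le> mle_L2_const s M * sqrt (1 / real n ^ (s - 2)) \<and>
               linf_norm n (\<lambda>v. Bh s v - B s v)
                 \<le> mle_linf_const s M * sqrt (ln (real n) / real n ^ (s - 1))))}"

lemma linf_norm_le_iff:
  assumes "n \<ge> 1"
  shows "linf_norm n x \<le> C \<longleftrightarrow> (\<forall>v\<in>{1..n}. \<bar>x v\<bar> \<le> C)"
  using assms by (simp add: linf_norm_def)

text \<open>The deterministic half: each layer is solved separately, and the solutions are assembled
  into one parameter family.\<close>

lemma mle_event_if_small_deviation:
  assumes n: "n \<ge> 1" "\<And>s. s \<in> {2..r} \<Longrightarrow> n \<ge> 2 * s"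
    and B: "\<And>s. s \<in> {2..r} \<Longrightarrow> linf_norm n (B s) \<le> M"
    and small: "\<And>s. s \<in> {2..r} \<Longrightarrow> mle_linf_const s M * sqrt (ln (real n) / real n ^ (s - 1)) < 1"
    and L2: "\<And>s. s \<in> {2..r} \<Longrightarrow>
        L2_set (\<lambda>v. real (sdegree H s v) - (\<Sum>e\<in>nsets_at {1..n} s v. edge_prob (B s) e)) {1..n}
          \<le> sqrt ((real s + 1) * real n ^ s)"
    and Linf: "\<And>s v. s \<in> {2..r} \<Longrightarrow> v \<in> {1..n} \<Longrightarrow>
        \<bar>real (sdegree H s v) - (\<Sum>e\<in>nsets_at {1..n} s v. edge_prob (B s) e)\<bar>
          \<le> sqrt (real n ^ (s - 1) * ln (real n))"
  shows "H \<in> mle_event r n M B"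
proof -
  let ?layer = "\<lambda>s b. (\<forall>v\<in>{1..n}. (\<Sum>e\<in>nsets_at {1..n} s v. logistic (\<Sum>u\<in>e. b u)) = real (sdegree H s v)) \<and>
            L2_set (\<lambda>v. b v - B s v) {1..n} \<le> mle_L2_const s M * sqrt (1 / real n ^ (s - 2)) \<and>
            (\<forall>v\<in>{1..n}. \<bar>b v - B s v\<bar> \<le> mle_linf_const s M * sqrt (ln (real n) / real n ^ (s - 1)))"
  have "\<exists>b. \<forall>s\<in>{2..r}. ?layer s (b s)"
  proof (rule bchoice, rule ballI)
    fix s assume s: "s \<in> {2..r}"
    have \<beta>: "\<bar>B s v\<bar> \<le> M" if "v \<in> {1..n}" for v
      using B[OF s] that by (simp add: linf_norm_le_iff[OF n(1)])
    obtain b where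
      "\<And>v. v \<in> {1..n} \<Longrightarrow> (\<Sum>e\<in>nsets_at {1..n} s v. logistic (\<Sum>u\<in>e. b u)) = real (sdegree H s v)"
      "L2_set (\<lambda>v. b v - B s v) {1..n} \<le> mle_L2_const s M * sqrt (1 / real n ^ (s - 2))"
      "\<And>v. v \<in> {1..n} \<Longrightarrow> \<bar>b v - B s v\<bar> \<le> mle_linf_const s M * sqrt (ln (real n) / real n ^ (s - 1))"
    proof (rule likelihood_solution_exists[of "{1..n}" s n "B s" M "\<lambda>v. real (sdegree H s v)"])
      show "finite {1..n}" "card {1..n} = n" "s \<ge> 2" using s by auto
    qed (rule n(2) s \<beta> small that
          L2[unfolded edge_prob_eq_logistic] Linf[unfolded edge_prob_eq_logistic] | assumption)+
    thus "\<exists>b. ?layer s b" by blast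
  qed
  then obtain b where b: "\<forall>s\<in>{2..r}. ?layer s (b s)" ..
  hence eq: "\<And>s v. s \<in> {2..r} \<Longrightarrow> v \<in> {1..n} \<Longrightarrow>
             (\<Sum>e\<in>nsets_at {1..n} s v. logistic (\<Sum>u\<in>e. b s u)) = real (sdegree H s v)"
    and b2: "\<And>s. s \<in> {2..r} \<Longrightarrow>
             L2_set (\<lambda>v. b s v - B s v) {1..n} \<le> mle_L2_const s M * sqrt (1 / real n ^ (s - 2))"
    and binf: "\<And>s v. s \<in> {2..r} \<Longrightarrow> v \<in> {1..n} \<Longrightarrow>
             \<bar>b s v - B s v\<bar> \<le> mle_linf_const s M * sqrt (ln (real n) / real n ^ (s - 1))"
    by blast+
  \<comment> \<open>Restriction to the index sets puts the family into \<open>param_space\<close>,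
    so uniqueness becomes equality of functions.\<close>
  define Bh where "Bh = (\<lambda>s\<in>{2..r}. \<lambda>v\<in>{1..n}. b s v)"
  have Bh: "Bh \<in> param_space r n" by (auto simp: Bh_def param_space_def)
  have sol: "likelihood_eqs r n H Bh"
    unfolding likelihood_eqs_iff
  proof (intro ballI)
    fix s v assume sv: "s \<in> {2..r}" "v \<in> {1..n}"
    have "(\<Sum>u\<in>e. Bh s u) = (\<Sum>u\<in>e. b s u)" if "e \<in> nsets_at {1..n} s v" for e
      using that sv by (intro sum.cong) (auto simp: Bh_def nsets_at_def nsets_def)
    thus "(\<Sum>e\<in>nsets_at {1..n} s v. logistic (\<Sum>u\<in>e. Bh s u)) = real (sdegree H s v)"
      using eq[OF sv] by simp
  qed
  have uniq: "Bh' = Bh" if Bh': "Bh' \<in> param_space r n" and sol': "likelihood_eqs r n H Bh'" for Bh'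
  proof -
    have eq_at: "Bh' s v = Bh s v" if s: "s \<in> {2..r}" and v: "v \<in> {1..n}" for s v
    proof (rule likelihood_solution_unique[OF _ _ _ _ v])
      show "2 \<le> s" "s + 1 \<le> card {1..n}" using n(2)[OF s] s by auto
      fix u assume u: "u \<in> {1..n}"
      show "(\<Sum>e\<in>nsets_at {1..n} s u. logistic (\<Sum>u\<in>e. Bh' s u))
              = (\<Sum>e\<in>nsets_at {1..n} s u. logistic (\<Sum>u\<in>e. Bh s u))"
        using sol[unfolded likelihood_eqs_iff, rule_format, OF s u]
          sol'[unfolded likelihood_eqs_iff, rule_format, OF s u] by (rule trans[OF _ sym, rotated])
    qed simp
    show ?thesis
    proof (rule PiE_ext)
      show "Bh' \<in> {2..r} \<rightarrow>\<^sub>E ({1..n} \<rightarrow>\<^sub>E UNIV)" "Bh \<in> {2..r} \<rightarrow>\<^sub>E ({1..n} \<rightarrow>\<^sub>E UNIV)"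
        using Bh Bh' by (simp_all add: param_space_def)
      fix s assume s: "s \<in> {2..r}"
      show "Bh' s = Bh s"
      proof (rule PiE_ext)
        show "Bh' s \<in> {1..n} \<rightarrow>\<^sub>E UNIV" "Bh s \<in> {1..n} \<rightarrow>\<^sub>E UNIV"
          using Bh Bh' s by (auto simp only: param_space_def PiE_mem)
      qed (rule eq_at[OF s])
    qed
  qed
  have bounds: "L2_set (\<lambda>v. Bh s v - B s v) {1..n} \<le> mle_L2_const s M * sqrt (1 / real n ^ (s - 2))"
      "linf_norm n (\<lambda>v. Bh s v - B s v) \<le> mle_linf_const s M * sqrt (ln (real n) / real n ^ (s - 1))"
    if s: "s \<in> {2..r}" for s
  proof -
    have "L2_set (\<lambda>v. Bh s v - B s v) {1..n} = L2_set (\<lambda>v. b s v - B s v) {1..n}"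
      using s by (intro L2_set_cong) (auto simp: Bh_def)
    thus "L2_set (\<lambda>v. Bh s v - B s v) {1..n} \<le> mle_L2_const s M * sqrt (1 / real n ^ (s - 2))"
      using b2[OF s] by simp
    show "linf_norm n (\<lambda>v. Bh s v - B s v) \<le> mle_linf_const s M * sqrt (ln (real n) / real n ^ (s - 1))"
      using binf[OF s] s by (auto simp: linf_norm_le_iff[OF n(1)] Bh_def)
  qed
  show ?thesis
    unfolding mle_event_def mem_Collect_eq
  proof (intro conjI ballI impI)
    show "\<exists>!Bh. Bh \<in> param_space r n \<and> likelihood_eqs r n H Bh"
      using Bh sol uniq by blast
  next
    fix Bh' s
    assume Bh': "Bh' \<in> param_space r n" "likelihood_eqs r n H Bh'" and s: "s \<in> {2..r}"
    show "L2_set (\<lambda>v. Bh' s v - B s v) {1..n} \<le> mle_L2_const s M * sqrt (1 / real n ^ (s - 2))"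
      and "linf_norm n (\<lambda>v. Bh' s v - B s v) \<le> mle_linf_const s M * sqrt (ln (real n) / real n ^ (s - 1))"
      unfolding uniq[OF Bh'] by (rule bounds[OF s])+
  qed
qed

text \<open>The probabilistic half: a union bound over the layers, carried out on the independent
  edge indicators and transferred to hypergraphs at the end.\<close>

lemma prob_mle_event_ge:
  assumes n: "n \<ge> 1" "\<And>s. s \<in> {2..r} \<Longrightarrow> n \<ge> 2 * s"
    and B: "\<And>s. s \<in> {2..r} \<Longrightarrow> linf_norm n (B s) \<le> M"
    and small: "\<And>s. s \<in> {2..r} \<Longrightarrow> mle_linf_const s M * sqrt (ln (real n) / real n ^ (s - 1)) < 1"
  shows "measure_pmf.prob (layered_beta_model r n B) (mle_event r n M B)
           \<ge> 1 - (\<Sum>s\<in>{2..r}. 2 * real s + 2) / real n"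
proof -
  define p where "p = (\<lambda>e. bernoulli_pmf (edge_prob (B (card e)) e))"
  define P where "P = Pi_pmf (potential_edges r n) False p"
  define dev where "dev = (\<lambda>s f v. \<Sum>e\<in>nsets_at {1..n} s v. of_bool (f e) - pmf (p e) True)"
  define bad where "bad = (\<lambda>s. {f. \<not> (L2_set (dev s f) {1..n} \<le> sqrt ((real s + 1) * real n ^ s) \<and>
                  (\<forall>v\<in>{1..n}. \<bar>dev s f v\<bar> \<le> sqrt (real n ^ (s - 1) * ln (real n))))})"
  have dev: "dev s f v = real (sdegree {e \<in> potential_edges r n. f e} s v)
               - (\<Sum>e\<in>nsets_at {1..n} s v. edge_prob (B s) e)" if "s \<in> {2..r}" for s f v
  proof -
    have "pmf (p e) True = edge_prob (B s) e" if "e \<in> nsets_at {1..n} s v" for e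
    proof -
      have "card e = s" using that by (simp add: nsets_at_def nsets_def)
      \<comment> \<open>The logistic value lies in the unit interval, so
        \<open>bernoulli_pmf\<close> takes it as its success probability.\<close>
      thus ?thesis
        using logistic_pos[of "\<Sum>v\<in>e. B s v"] logistic_less_1[of "\<Sum>v\<in>e. B s v"]
        by (simp add: p_def edge_prob_eq_logistic)
    qed
    thus ?thesis using that by (simp add: dev_def sum_subtractf sdegree_eq_sum)
  qed
  have "measure_pmf.prob P (\<Union>s\<in>{2..r}. bad s) \<le> (\<Sum>s\<in>{2..r}. measure_pmf.prob P (bad s))"
    by (intro measure_pmf.finite_measure_subadditive_finite) auto
  also have "\<dots> \<le> (\<Sum>s\<in>{2..r}. (2 * real s + 2) / real n)"
  proof (rule sum_mono)
    fix s assume s: "s \<in> {2..r}"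
    have card: "card {1..n} = n" by simp
    show "measure_pmf.prob P (bad s) \<le> (2 * real s + 2) / real n"
      unfolding P_def bad_def dev_def
    proof (rule prob_degree_deviation[of "{1..n}", unfolded card])
      show "1 \<le> s" "s \<le> n" using s n(2)[OF s] by auto
      show "finite (potential_edges r n)"
        by (auto simp: potential_edges_def finite_imp_finite_nsets)
      show "nsets {1..n} s \<subseteq> potential_edges r n"
        using s by (auto simp: potential_edges_def)
    qed simp
  qed
  finally have bad: "measure_pmf.prob P (\<Union>s\<in>{2..r}. bad s) \<le> (\<Sum>s\<in>{2..r}. 2 * real s + 2) / real n"
    by (simp add: sum_divide_distrib)
  let ?G = "(\<lambda>f. {e \<in> potential_edges r n. f e}) -` mle_event r n M B"
  have "- (\<Union>s\<in>{2..r}. bad s) \<subseteq> ?G"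
  proof
    fix f assume f: "f \<in> - (\<Union>s\<in>{2..r}. bad s)"
    have good: "L2_set (dev s f) {1..n} \<le> sqrt ((real s + 1) * real n ^ s)"
        "v \<in> {1..n} \<Longrightarrow> \<bar>dev s f v\<bar> \<le> sqrt (real n ^ (s - 1) * ln (real n))"
      if "s \<in> {2..r}" for s v
    proof -
      have "f \<notin> bad s" using f that by blast
      thus "L2_set (dev s f) {1..n} \<le> sqrt ((real s + 1) * real n ^ s)"
          "v \<in> {1..n} \<Longrightarrow> \<bar>dev s f v\<bar> \<le> sqrt (real n ^ (s - 1) * ln (real n))"
        unfolding bad_def by blast+
    qed
    show "f \<in> ?G"
      unfolding vimage_eq
      by (rule mle_event_if_small_deviation[OF n B small]) (simp_all only: dev[symmetric] good)
  qed
  hence "1 - measure_pmf.prob P (\<Union>s\<in>{2..r}. bad s) \<le> measure_pmf.prob P ?G"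
    using measure_pmf.prob_compl[of "\<Union>s\<in>{2..r}. bad s" P]
      measure_pmf.finite_measure_mono[of "- (\<Union>s\<in>{2..r}. bad s)" ?G P]
    by (simp add: Compl_eq_Diff_UNIV)
  also have "measure_pmf.prob P ?G = measure_pmf.prob (layered_beta_model r n B) (mle_event r n M B)"
    by (simp add: layered_beta_model_def P_def p_def)
  finally show ?thesis using bad by linarith
qed

text \<open>Since \<open>s - 1 \<ge> 1\<close>, the rate is dominated by
  \<open>sqrt (ln n / n)\<close>, which tends to 0.\<close>

lemma eventually_linf_rate_small:
  assumes "s \<ge> 2"
  shows "eventually (\<lambda>n. C * sqrt (ln (real n) / real n ^ (s - 1)) < 1) sequentially"
proof -
  have "(\<lambda>n. \<bar>C\<bar> * sqrt (ln (real n) / real n)) \<longlonglongrightarrow> \<bar>C\<bar> * sqrt 0"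
    by (intro tendsto_intros lim_ln_over_n)
  hence "eventually (\<lambda>n. \<bar>C\<bar> * sqrt (ln (real n) / real n) < 1) sequentially"
    by (intro order_tendstoD) auto
  thus ?thesis
    using eventually_ge_at_top[of 1]
  proof eventually_elim
    case (elim n)
    have "real n ^ 1 \<le> real n ^ (s - 1)" using elim assms by (intro power_increasing) auto
    hence "ln (real n) / real n ^ (s - 1) \<le> ln (real n) / real n"
      using elim by (intro divide_left_mono) auto
    hence "\<bar>C\<bar> * sqrt (ln (real n) / real n ^ (s - 1)) \<le> \<bar>C\<bar> * sqrt (ln (real n) / real n)"
      by (intro mult_left_mono real_sqrt_le_mono) auto
    moreover have "C * sqrt (ln (real n) / real n ^ (s - 1)) \<le> \<bar>C\<bar> * sqrt (ln (real n) / real n ^ (s - 1))"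
      using elim by (intro mult_right_mono) auto
    ultimately show ?case using elim by linarith
  qed
qed

theorem theorem2p1:
  "\<exists>C2 Cinf :: nat \<Rightarrow> real \<Rightarrow> real.
     (\<forall>s M. C2 s M > 0 \<and> Cinf s M > 0) \<and>
     (\<forall>(r::nat) (M::real) (B :: nat \<Rightarrow> nat \<Rightarrow> nat \<Rightarrow> real).
        r \<ge> 2 \<longrightarrow> M > 0 \<longrightarrow>
        (\<forall>n\<ge>1. \<forall>s\<in>{2..r}. linf_norm n (B n s) \<le> M) \<longrightarrow>
        (\<lambda>n. measure_pmf.prob (layered_beta_model r n (B n))
           {H. (\<exists>!Bh. Bh \<in> param_space r n \<and> likelihood_eqs r n H Bh) \<and>
               (\<forall>Bh \<in> param_space r n. likelihood_eqs r n H Bh \<longrightarrow>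
                  (\<forall>s\<in>{2..r}.
                     L2_set (\<lambda>v. Bh s v - B n s v) {1..n}
                       \<le> C2 s M * sqrt (1 / real n ^ (s - 2)) \<and>
                     linf_norm n (\<lambda>v. Bh s v - B n s v)
                       \<le> Cinf s M * sqrt (ln (real n) / real n ^ (s - 1))))})
          \<longlonglongrightarrow> 1)"
proof (rule exI[of _ mle_L2_const], rule exI[of _ mle_linf_const], intro conjI allI impI,
    goal_cases)
  \<comment> \<open>The witnesses depend only on \<open>s\<close> and \<open>M\<close>. This goal is
    the convergence; the other two are positivity.\<close>
  case (3 r M B)
  let ?K = "\<Sum>s\<in>{2..r}. 2 * real s + 2"
  have "eventually (\<lambda>n. \<forall>s\<in>{2..r}. mle_linf_const s M * sqrt (ln (real n) / real n ^ (s - 1)) < 1)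
          sequentially"
    by (intro eventually_ball_finite ballI eventually_linf_rate_small) auto
  hence lower: "eventually (\<lambda>n. 1 - ?K / real n
          \<le> measure_pmf.prob (layered_beta_model r n (B n)) (mle_event r n M (B n))) sequentially"
    \<comment> \<open>From this index on, \<open>n \<ge> 2 * s\<close> for every layer
      \<open>s \<le> r\<close>.\<close>
    using eventually_ge_at_top[of "2 * r + 1"]
  proof eventually_elim
    case (elim n)
    show ?case
      using elim 3 by (intro prob_mle_event_ge) auto
  qed
  have "(\<lambda>n. 1 - ?K / real n) \<longlonglongrightarrow> 1 - 0"
    by (intro tendsto_diff tendsto_const lim_const_over_n)
  hence "(\<lambda>n. 1 - ?K / real n) \<longlonglongrightarrow> 1" by simp
  from tendsto_sandwich[OF lower _ this tendsto_const]
  have "(\<lambda>n. measure_pmf.prob (layered_beta_model r n (B n)) (mle_event r n M (B n))) \<longlonglongrightarrow> 1"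
    by (simp add: measure_pmf.prob_le_1)
  thus ?case unfolding mle_event_def .
qed (simp_all add: mle_L2_const_pos mle_linf_const_pos)

end
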